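(* Let $n\ge 2$ be a fixed integer. Let $\mathcal{A}$ be a von Neumann algebra without central abelian projections and let $\mathcal{B}$ be a $\ast$-algebra. Let $\eta$ be a non-zero complex scalar with $\eta\neq -1$. Suppose that $\phi$ is a (not necessarily linear) bijective map from $\mathcal{A}$ to $\mathcal{B}$ with $$\phi(p_n(x_1,x_2,\dots,x_n))=p_n(\phi(x_1),\phi(x_2),\dots,\phi(x_n))$$ for all $x_1,x_2,\dots,x_n\in\mathcal{A}$. Then $\phi$ is additive, i.e. $\phi(A+B)=\phi(A)+\phi(B)$ for all $A,B\in\mathcal{A}$.
   Context: All algebras are over $\mathbb{C}$; a von Neumann algebra is a weakly closed self-adjoint algebra of operators on a Hilbert space containing the identity operator $I$. For a non-zero scalar $\eta\in\mathbb{C}$, the Jordan $\eta$-$\ast$-product of two elements of a $\ast$-algebra is $A\Diamond_\eta B=AB+\eta BA^\ast$ (not associative in general). The Jordan $\eta$-$\ast$-$n$-product is defined recursively by $p_2(x_1,x_2)=x_1\Diamond_\eta x_2$ and $p_n(x_1,\dots,x_n)=p_{n-1}(x_1,\dots,x_{n-1})\Diamond_\eta x_n$ for $n\ge 3$. A projection $P$ in a von Neumann algebra $\mathcal{A}$ is a central abelian projection if $P$ lies in the center of $\mathcal{A}$ and $P\mathcal{A}P$ is abelian; "without central abelian projections" means there is no non-zero such projection. *)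

theory Defs
  imports "HOL-Analysis.Analysis"
begin

section \<open>Complex Hilbert spaces\<close>

class complex_vector = ab_group_add +
  fixes scaleC :: "complex \<Rightarrow> 'a \<Rightarrow> 'a"  (infixr "*\<^sub>C" 75)
  assumes scaleC_add_right: "c *\<^sub>C (x + y) = c *\<^sub>C x + c *\<^sub>C y"
    and scaleC_add_left: "(c + d) *\<^sub>C x = c *\<^sub>C x + d *\<^sub>C x"
    and scaleC_scaleC: "c *\<^sub>C (d *\<^sub>C x) = (c * d) *\<^sub>C x"
    and scaleC_one: "1 *\<^sub>C x = x"

text \<open>The inner product is linear in the first and conjugate linear in the second argument. The axiom
  \<open>cinner_self\<close> expresses positive definiteness and says that the norm of the Banach
  space is the one induced by the inner product.\<close>

class complex_hilbert_space = complex_vector + banach +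
  fixes cinner :: "'a \<Rightarrow> 'a \<Rightarrow> complex"
  assumes scaleR_scaleC: "r *\<^sub>R x = complex_of_real r *\<^sub>C x"
    and cinner_add_left: "cinner (x + y) z = cinner x z + cinner y z"
    and cinner_scaleC_left: "cinner (c *\<^sub>C x) y = c * cinner x y"
    and cinner_commute: "cinner x y = cnj (cinner y x)"
    and cinner_self: "cinner x x = complex_of_real ((norm x)\<^sup>2)"

lemma cinner_add_right: "cinner x (y + z) = cinner x y + cinner x z"
  by (metis cinner_commute cinner_add_left complex_cnj_add)

lemma cinner_scaleC_right: "cinner x (c *\<^sub>C y) = cnj c * cinner x y"
  by (metis cinner_commute cinner_scaleC_left complex_cnj_mult)

lemma cinner_scaleR_left: "cinner (r *\<^sub>R x) y = complex_of_real r * cinner x y"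
  by (simp add: scaleR_scaleC cinner_scaleC_left)

lemma cinner_scaleR_right: "cinner x (r *\<^sub>R y) = complex_of_real r * cinner x y"
  by (simp add: scaleR_scaleC cinner_scaleC_right)

lemma cinner_diff_left: "cinner (x - y) z = cinner x z - cinner y z"
  by (metis cinner_add_left add_diff_cancel diff_add_cancel)

lemma cinner_diff_right: "cinner x (y - z) = cinner x y - cinner x z"
  by (metis cinner_add_right add_diff_cancel diff_add_cancel)

lemma norm_scaleC: "norm (c *\<^sub>C x) = cmod c * norm (x :: 'a::complex_hilbert_space)"
proof -
  have "complex_of_real ((norm (c *\<^sub>C x))\<^sup>2) = (c * cnj c) * complex_of_real ((norm x)\<^sup>2)"
    unfolding cinner_self[symmetric] by (simp add: cinner_scaleC_left cinner_scaleC_right)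
  also have "\<dots> = complex_of_real ((cmod c * norm x)\<^sup>2)"
    by (simp only: complex_norm_square[symmetric] of_real_mult[symmetric] power_mult_distrib)
  finally have "(norm (c *\<^sub>C x))\<^sup>2 = (cmod c * norm x)\<^sup>2"
    using of_real_eq_iff by blast
  then show ?thesis by simp
qed

lemma cinner_eqI:
  assumes "\<And>x. cinner x y = cinner x z"
  shows "y = z"
proof -
  have "cinner (y - z) (y - z) = 0"
    unfolding cinner_diff_right[of _ y z] using assms by simp
  then show ?thesis by (simp add: cinner_self)
qed

lemma norm_add_sq: "(norm (x + y))\<^sup>2 = (norm x)\<^sup>2 + 2 * Re (cinner x y) + (norm y)\<^sup>2"
proof -
  have "complex_of_real ((norm (x + y))\<^sup>2) = cinner (x + y) (x + y)" 
    by (simp only: cinner_self)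
  also have "\<dots> = cinner x x + (cinner x y + cnj (cinner x y)) + cinner y y"
    by (simp add: cinner_add_left cinner_add_right cinner_commute[of y x])
  finally have "Re (complex_of_real ((norm (x + y))\<^sup>2)) = 
      Re (cinner x x + (cinner x y + cnj (cinner x y)) + cinner y y)" by simp
  then show ?thesis by (simp add: cinner_self del: of_real_power)
qed

lemma Re_cinner_le: "Re (cinner x y) \<le> norm x * norm y"
proof -
  have "(norm (x + y))\<^sup>2 \<le> (norm x + norm y)\<^sup>2"
    by (simp add: norm_triangle_ineq power_mono)
  then show ?thesis by (simp add: norm_add_sq power2_sum)
qed

section \<open>Operators\<close>

text \<open>Bounded operators on \<open>'h\<close> are represented in the type of bounded
  \<^emph>\<open>real\<close> linear maps \<^typ>\<open>'h \<Rightarrow>\<^sub>L 'h\<close>; the complex linear ones are singled out here.\<close>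

definition clinear_ops :: "('h::complex_hilbert_space \<Rightarrow>\<^sub>L 'h) set" where
  "clinear_ops = {T. \<forall>c x. blinfun_apply T (c *\<^sub>C x) = c *\<^sub>C T x}"

instantiation blinfun :: (real_normed_vector, complex_hilbert_space) complex_vector
begin

lift_definition scaleC_blinfun :: "complex \<Rightarrow> 'a \<Rightarrow>\<^sub>L 'b \<Rightarrow> 'a \<Rightarrow>\<^sub>L 'b"
  is "\<lambda>c T x. c *\<^sub>C T x"
proof -
  fix c :: complex and T :: "'a \<Rightarrow> 'b"
  assume "bounded_linear T"
  then interpret T: bounded_linear T .
  show "bounded_linear (\<lambda>x. c *\<^sub>C T x)"
  proof (rule bounded_linear_intro)
    show "c *\<^sub>C T (x + y) = c *\<^sub>C T x + c *\<^sub>C T y" for x y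
      by (simp add: T.add scaleC_add_right)
    show "c *\<^sub>C T (r *\<^sub>R x) = r *\<^sub>R (c *\<^sub>C T x)" for r x
      by (simp add: T.scaleR scaleR_scaleC scaleC_scaleC mult.commute)
    show "norm (c *\<^sub>C T x) \<le> norm x * (cmod c * onorm T)" for x
      using mult_left_mono[OF onorm[OF \<open>bounded_linear T\<close>, of x] norm_ge_zero[of c]]
      by (simp add: norm_scaleC ac_simps)
  qed
qed

instance
proof
  fix c d :: complex and S T :: "'a \<Rightarrow>\<^sub>L 'b"
  show "c *\<^sub>C (S + T) = c *\<^sub>C S + c *\<^sub>C T"
    by (rule blinfun_eqI) (simp add: scaleC_blinfun.rep_eq blinfun.add_left scaleC_add_right)
  show "(c + d) *\<^sub>C T = c *\<^sub>C T + d *\<^sub>C T"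
    by (rule blinfun_eqI) (simp add: scaleC_blinfun.rep_eq blinfun.add_left scaleC_add_left)
  show "c *\<^sub>C (d *\<^sub>C T) = (c * d) *\<^sub>C T"
    by (rule blinfun_eqI) (simp add: scaleC_blinfun.rep_eq scaleC_scaleC)
  show "1 *\<^sub>C T = T"
    by (rule blinfun_eqI) (simp add: scaleC_blinfun.rep_eq scaleC_one)
qed

end

definition adj :: "('h::complex_hilbert_space \<Rightarrow>\<^sub>L 'h) \<Rightarrow> ('h \<Rightarrow>\<^sub>L 'h)" where
  "adj T = (THE S :: 'h \<Rightarrow>\<^sub>L 'h. \<forall>x y. cinner (T x) y = cinner x (S y))"

text \<open>The adjoint of a bounded complex linear operator exists, by the Riesz representation
  theorem, so that the description above is proper.\<close>

lemma riesz_real: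
  fixes g :: "'h::complex_hilbert_space \<Rightarrow> real"
  assumes "bounded_linear g"
  obtains z where "\<And>x. g x = Re (cinner x z)"
proof -
  interpret g: bounded_linear g by fact
  define F where "F x = (norm x)\<^sup>2 - 2 * g x" for x
  obtain K where K: "\<And>x. norm (g x) \<le> norm x * K" using g.bounded by blast
  have lower: "F x \<ge> - K\<^sup>2" for x
  proof -
    have "g x \<le> norm x * K" using K[of x] by simp
    moreover have "(norm x - K)\<^sup>2 \<ge> 0" by simp
    ultimately show ?thesis by (simp add: F_def power2_diff)
  qed
  define m where "m = Inf (range F)"
  have bdd: "bdd_below (range F)" by (rule bdd_belowI2[OF lower])
  have m_le: "m \<le> F x" for x unfolding m_def by (rule cInf_lower[OF _ bdd]) simp
  have "\<exists>x. F x < m + inverse (Suc n)" for n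
    using cInf_lessD[of "range F" "m + inverse (Suc n)"] by (auto simp: m_def)
  then obtain u where u: "\<And>n. F (u n) < m + inverse (Suc n)" by metis
  have par: "(norm (x - y))\<^sup>2 = 2 * F x + 2 * F y - 4 * F ((1/2) *\<^sub>R (x + y))" for x y
  proof -
    have "(norm (x + y))\<^sup>2 + (norm (x + - y))\<^sup>2 = 2 * (norm x)\<^sup>2 + 2 * (norm y)\<^sup>2"
      using cinner_scaleR_right[of x "-1" y] unfolding norm_add_sq by simp
    moreover have "F ((1/2) *\<^sub>R (x + y)) = (norm (x + y))\<^sup>2 / 4 - (g x + g y)"
      unfolding F_def g.scaleR g.add norm_scaleR by (simp add: power_divide field_simps)
    ultimately show ?thesis by (simp add: F_def)
  qed
  have dist: "(dist (u i) (u j))\<^sup>2 < 2 * inverse (Suc i) + 2 * inverse (Suc j)" for i j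
    using par[of "u i" "u j"] m_le[of "(1/2) *\<^sub>R (u i + u j)"] u[of i] u[of j]
    by (simp add: dist_norm)
  have "Cauchy u"
  proof (rule metric_CauchyI)
    fix e :: real assume "e > 0"
    then obtain N where N: "inverse (Suc N) < e\<^sup>2 / 4"
      using reals_Archimedean[of "e\<^sup>2 / 4"] by auto
    have "dist (u i) (u j) < e" if "i \<ge> N" "j \<ge> N" for i j
    proof -
      have "inverse (real (Suc i)) \<le> inverse (real (Suc N))" 
           "inverse (real (Suc j)) \<le> inverse (real (Suc N))"
        using that by (auto intro!: le_imp_inverse_le)
      then have "(dist (u i) (u j))\<^sup>2 < e\<^sup>2" using dist[of i j] N by linarith
      then show ?thesis using \<open>e > 0\<close> by (simp add: power2_less_imp_less)
    qed
    then show "\<exists>M. \<forall>i\<ge>M. \<forall>j\<ge>M. dist (u i) (u j) < e" by blast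
  qed
  then obtain z where z: "u \<longlonglongrightarrow> z" using Cauchy_convergent convergent_def by blast
  have "(\<lambda>n. F (u n)) \<longlonglongrightarrow> F z"
    unfolding F_def by (intro tendsto_intros z g.tendsto)
  moreover have "(\<lambda>n. m + inverse (Suc n)) \<longlonglongrightarrow> m + 0"
    by (intro tendsto_intros LIMSEQ_inverse_real_of_nat)
  ultimately have "F z \<le> m + 0"
    by (rule LIMSEQ_le) (use u less_imp_le in blast)
  then have min: "F z \<le> F x" for x using m_le[of x] by simp
  have "g x = Re (cinner x z)" for x
  proof -
    define d where "d = Re (cinner x z) - g x"
    have *: "0 \<le> 2 * t * d + t\<^sup>2 * (norm x)\<^sup>2" for t
    proof -
      have "Re (cinner z x) = Re (cinner x z)"
        by (subst cinner_commute) simp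
      then show ?thesis
        using min[of "z + t *\<^sub>R x"]
        by (simp add: F_def norm_add_sq g.add g.scaleR cinner_scaleR_right d_def
            power_mult_distrib algebra_simps)
    qed
    define s where "s = - d / ((norm x)\<^sup>2 + 1)"
    have p: "(norm x)\<^sup>2 + 1 > 0" by (simp add: add_nonneg_pos)
    then have sd: "d = - s * ((norm x)\<^sup>2 + 1)" by (simp add: s_def)
    have "0 \<le> 2 * s * (- s * ((norm x)\<^sup>2 + 1)) + s\<^sup>2 * (norm x)\<^sup>2"
      using *[of s] unfolding sd .
    then have "s\<^sup>2 * ((norm x)\<^sup>2 + 2) \<le> 0" by (simp add: algebra_simps power2_eq_square)
    then have "s = 0" using p by (simp add: mult_le_0_iff not_le add_nonneg_pos)
    then show ?thesis using sd by (simp add: d_def)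
  qed
  then show ?thesis using that by blast
qed

lemma adj_exists:
  fixes T :: "'h::complex_hilbert_space \<Rightarrow>\<^sub>L 'h"
  assumes "T \<in> clinear_ops"
  shows "\<exists>!S :: 'h \<Rightarrow>\<^sub>L 'h. \<forall>x y. cinner (T x) y = cinner x (S y)"
proof -
  have "\<exists>z. \<forall>x. cinner (T x) y = cinner x z" for y
  proof -
    have "bounded_linear (\<lambda>x. Re (cinner (T x) y))"
    proof (rule bounded_linear_intro)
      fix x
      have "\<bar>Re (cinner (T x) y)\<bar> \<le> norm (T x) * norm y"
        using Re_cinner_le[of "T x" y] Re_cinner_le[of "(-1) *\<^sub>R T x" y]
        unfolding cinner_scaleR_left by auto
      also have "\<dots> \<le> norm x * (norm T * norm y)"
        using mult_right_mono[OF norm_blinfun[of T x] norm_ge_zero[of y]] by (simp add: ac_simps)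
      finally show "norm (Re (cinner (T x) y)) \<le> norm x * (norm T * norm y)" by simp
    qed (simp_all add: blinfun.add_right blinfun.scaleR_right cinner_add_left cinner_scaleR_left)
    then obtain z where z: "\<And>x. Re (cinner (T x) y) = Re (cinner x z)"
      using riesz_real by metis
    have "Im (cinner (T x) y) = Im (cinner x z)" for x
      using z[of "\<i> *\<^sub>C x"] assms by (simp add: clinear_ops_def cinner_scaleC_left)
    with z show ?thesis by (auto simp: complex_eq_iff)
  qed
  then obtain S where S: "\<And>x y. cinner (T x) y = cinner x (S y)" by metis
  have "bounded_linear S"
  proof (rule bounded_linear_intro)
    show "S (x + y) = S x + S y" for x y
      by (rule cinner_eqI) (simp add: S[symmetric] cinner_add_right)
    show "S (r *\<^sub>R x) = r *\<^sub>R S x" for r x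
      by (rule cinner_eqI) (simp add: S[symmetric] cinner_scaleR_right)
    show "norm (S y) \<le> norm y * norm T" for y
    proof -
      have "norm (S y) * norm (S y) = Re (cinner (T (S y)) y)"
        unfolding S cinner_self by (simp add: power2_eq_square)
      also have "\<dots> \<le> norm (T (S y)) * norm y" by (rule Re_cinner_le)
      also have "\<dots> \<le> norm (S y) * (norm y * norm T)"
        using mult_right_mono[OF norm_blinfun[of T "S y"] norm_ge_zero[of y]]
        by (simp add: ac_simps)
      finally show ?thesis
        by (cases "S y = 0") (simp_all add: mult_le_cancel_left)
    qed
  qed
  then have "\<forall>x y. cinner (T x) y = cinner x (Blinfun S y)"
    by (simp add: S bounded_linear_Blinfun_apply)
  then show ?thesis
  proof (rule ex1I)
    fix S' :: "'h \<Rightarrow>\<^sub>L 'h"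
    assume "\<forall>x y. cinner (T x) y = cinner x (S' y)"
    then have "S' y = S y" for y by (intro cinner_eqI) (simp add: S[symmetric])
    then show "S' = Blinfun S"
      by (intro blinfun_eqI) (simp add: \<open>bounded_linear S\<close> bounded_linear_Blinfun_apply)
  qed
qed

lemma cinner_adj:
  "T \<in> clinear_ops \<Longrightarrow> cinner (T x) y = cinner x (adj T y)"
  using theI'[OF adj_exists[of T]] unfolding adj_def by blast

section \<open>Von Neumann algebras\<close>

text \<open>The coarsest topology making all maps \<open>T \<mapsto> \<langle>T x, y\<rangle>\<close> continuous; the function space
  \<^typ>\<open>'h \<Rightarrow> 'h \<Rightarrow> complex\<close> carries the product topology.\<close>

definition weak_operator_topology :: "('h::complex_hilbert_space \<Rightarrow>\<^sub>L 'h) topology" where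
  "weak_operator_topology = pullback_topology UNIV (\<lambda>T x y. cinner (blinfun_apply T x) y) euclidean"

definition von_neumann_algebra :: "('h::complex_hilbert_space \<Rightarrow>\<^sub>L 'h) set \<Rightarrow> bool" where
  "von_neumann_algebra \<A> \<longleftrightarrow>
     \<A> \<subseteq> clinear_ops \<and>
     id_blinfun \<in> \<A> \<and>
     (\<forall>S\<in>\<A>. \<forall>T\<in>\<A>. S + T \<in> \<A>) \<and>
     (\<forall>c. \<forall>T\<in>\<A>. c *\<^sub>C T \<in> \<A>) \<and>
     (\<forall>S\<in>\<A>. \<forall>T\<in>\<A>. S o\<^sub>L T \<in> \<A>) \<and>
     (\<forall>T\<in>\<A>. adj T \<in> \<A>) \<and>
     closedin weak_operator_topology \<A>"

definition central_abelian_projection ::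
    "('h::complex_hilbert_space \<Rightarrow>\<^sub>L 'h) set \<Rightarrow> ('h \<Rightarrow>\<^sub>L 'h) \<Rightarrow> bool" where
  "central_abelian_projection \<A> P \<longleftrightarrow>
     P \<in> \<A> \<and> P o\<^sub>L P = P \<and> adj P = P \<and>
     (\<forall>T\<in>\<A>. P o\<^sub>L T = T o\<^sub>L P) \<and>
     (\<forall>S\<in>\<A>. \<forall>T\<in>\<A>. (P o\<^sub>L S o\<^sub>L P) o\<^sub>L (P o\<^sub>L T o\<^sub>L P) = (P o\<^sub>L T o\<^sub>L P) o\<^sub>L (P o\<^sub>L S o\<^sub>L P))"

definition without_central_abelian_projections ::
    "('h::complex_hilbert_space \<Rightarrow>\<^sub>L 'h) set \<Rightarrow> bool" where
  "without_central_abelian_projections \<A> \<longleftrightarrow>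
     (\<nexists>P. central_abelian_projection \<A> P \<and> P \<noteq> 0)"

section \<open>Jordan \<open>\<eta>\<close>-\<open>*\<close>-products\<close>

text \<open>A \<open>*\<close>-algebra is associative but need not have a unit.\<close>

class star_algebra = complex_vector + ring +
  fixes star :: "'a \<Rightarrow> 'a"
  assumes mult_scaleC_left: "(c *\<^sub>C x) * y = c *\<^sub>C (x * y)"
    and mult_scaleC_right: "x * (c *\<^sub>C y) = c *\<^sub>C (x * y)"
    and star_star: "star (star x) = x"
    and star_add: "star (x + y) = star x + star y"
    and star_scaleC: "star (c *\<^sub>C x) = cnj c *\<^sub>C star x"
    and star_mult: "star (x * y) = star y * star x"

text \<open>The products are parametrized by the multiplication and the involution, since operators
  are multiplied by \<^const>\<open>blinfun_compose\<close> and abstract elements by \<^const>\<open>times\<close>.\<close>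

definition jordan_prod ::
    "('a \<Rightarrow> 'a \<Rightarrow> 'a) \<Rightarrow> ('a \<Rightarrow> 'a) \<Rightarrow> complex \<Rightarrow> 'a::complex_vector \<Rightarrow> 'a \<Rightarrow> 'a" where
  "jordan_prod mul invol \<eta> a b = mul a b + \<eta> *\<^sub>C mul b (invol a)"

definition jordan_n_prod ::
    "('a \<Rightarrow> 'a \<Rightarrow> 'a) \<Rightarrow> ('a \<Rightarrow> 'a) \<Rightarrow> complex \<Rightarrow> 'a::complex_vector list \<Rightarrow> 'a" where
  "jordan_n_prod mul invol \<eta> xs = foldl (jordan_prod mul invol \<eta>) (hd xs) (tl xs)"

lemma jordan_n_prod_two:
  "jordan_n_prod mul invol \<eta> [x, y] = jordan_prod mul invol \<eta> x y"
  by (simp add: jordan_n_prod_def)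

lemma jordan_n_prod_snoc:
  "xs \<noteq> [] \<Longrightarrow>
    jordan_n_prod mul invol \<eta> (xs @ [y]) = jordan_prod mul invol \<eta> (jordan_n_prod mul invol \<eta> xs) y"
  by (simp add: jordan_n_prod_def)

end

theory Submission
  imports Defs
begin

text \<open>Put \<open>F X Y = p\<^sub>n(I, \<dots>, I, X, Y) = \<alpha> X Y + \<beta> Y X\<^sup>*\<close>. Then \<open>\<phi> (F X Y) = G (\<phi> X) (\<phi> Y)\<close> with a biadditive \<open>G\<close>,
  so that \<open>F\<close> maps a relation \<open>\<phi> T = \<phi> A + \<phi> B\<close> to another one and the defect \<open>S = T - (A + B)\<close> is
  annihilated by every such operation after which \<open>\<phi>\<close> is already known to be additive.
  Peirce decomposition with respect to an arbitrary projection \<open>P\<close> shows in this way that \<open>S\<close> commutes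
  with \<open>P\<close> and annihilates all commutators \<open>P C - C P\<close>. Since the projections generate the algebra in
  norm, \<open>S\<close> is central and annihilates all commutators. The complement of the kernel
  projection of \<open>S\<^sup>* S\<close> is then a central abelian projection, hence zero, and so \<open>S = 0\<close>. Using all
  projections at once avoids comparison theory and central carriers.\<close>

section \<open>Peirce decomposition in unital \<open>*\<close>-subalgebras\<close>

text \<open>Nothing is known about how \<open>\<phi>\<close> treats scalars or ordinary products, so
  information passes only through \<open>F\<close> and \<open>G\<close>. A defect is probed with
  elements on which \<open>F\<close> acts on each Peirce corner by a scalar. A probe shows a corner
  of the defect to be zero only if its scalar there is non-zero and additivity is already known for
  the probed elements. If \<open>\<eta>\<close> has modulus 1, some of these scalars can vanish, so
  the probes are chosen to rely only on scalars that the hypotheses on \<open>\<eta>\<close> keep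
  away from zero.

  For two elements of the same diagonal corner probing is circular: a probe that sees
  \<open>P A P\<close> leaves both terms there. Their defect is instead multiplied into
  \<open>P A Q\<close>, where additivity is available, and only an annihilation condition results.
  For a single \<open>P\<close> this may say nothing (take \<open>P = 0\<close>); this is what
  forces the use of many projections.

  That projections generate the algebra is obtained without a spectral theorem: a self-adjoint
  contraction has a binary expansion whose digits are symmetries \<open>I - 2P\<close>, and each
  digit comes from a square root and a kernel projection.\<close>

lemma scaleC_zero_left [simp]: "0 *\<^sub>C x = 0"
  using scaleC_add_left[of 0 0 x] by simp

lemma scaleC_zero_right [simp]: "c *\<^sub>C 0 = (0 :: 'a::complex_vector)"
  using scaleC_add_right[of c 0 "0 :: 'a"] by simp

lemma scaleC_minus_left: "(- c) *\<^sub>C x = - (c *\<^sub>C x)"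
  using scaleC_add_left[of "- c" c x] by (simp add: eq_neg_iff_add_eq_0)

lemma scaleC_minus_right: "c *\<^sub>C (- x) = - (c *\<^sub>C x)"
  using scaleC_add_right[of c "- x" x] by (simp add: eq_neg_iff_add_eq_0)

lemma scaleC_diff_right: "c *\<^sub>C (x - y) = c *\<^sub>C x - c *\<^sub>C y"
  using scaleC_add_right[of c x "- y"] by (simp add: scaleC_minus_right)

lemma scaleC_eq_0_iff: "c *\<^sub>C x = 0 \<longleftrightarrow> c = 0 \<or> x = 0"
proof -
  have "x = 0" if "c \<noteq> 0" "c *\<^sub>C x = 0"
  proof -
    have "x = (inverse c * c) *\<^sub>C x" using that(1) by (simp add: scaleC_one)
    also have "\<dots> = 0" by (simp only: scaleC_scaleC[symmetric] that(2) scaleC_zero_right)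
    finally show ?thesis .
  qed
  then show ?thesis by auto
qed

text \<open>The ambient type contains all bounded real linear maps. Laws that need complex
  linearity, or the existence of an adjoint, are therefore required only on the carrier
  \<open>A\<close>.\<close>

locale unital_star_subalgebra =
  fixes A :: "'a::complex_vector set"
    and mul :: "'a \<Rightarrow> 'a \<Rightarrow> 'a"  (infixl "\<odot>" 70)
    and st :: "'a \<Rightarrow> 'a"
    and e :: 'a
  assumes mul_assoc: "(x \<odot> y) \<odot> z = x \<odot> (y \<odot> z)"
    and mul_add_left: "(x + y) \<odot> z = x \<odot> z + y \<odot> z"
    and mul_add_right: "z \<odot> (x + y) = z \<odot> x + z \<odot> y"
    and mul_scaleC_left: "(c *\<^sub>C x) \<odot> y = c *\<^sub>C (x \<odot> y)"
    and mul_scaleC_right: "x \<in> A \<Longrightarrow> x \<odot> (c *\<^sub>C y) = c *\<^sub>C (x \<odot> y)"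
    and unit_left: "e \<odot> x = x"
    and unit_right: "x \<odot> e = x"
    and unit_mem: "e \<in> A"
    and add_mem: "x \<in> A \<Longrightarrow> y \<in> A \<Longrightarrow> x + y \<in> A"
    and scaleC_mem: "x \<in> A \<Longrightarrow> c *\<^sub>C x \<in> A"
    and mul_mem: "x \<in> A \<Longrightarrow> y \<in> A \<Longrightarrow> x \<odot> y \<in> A"
    and st_mem: "x \<in> A \<Longrightarrow> st x \<in> A"
    and st_add: "x \<in> A \<Longrightarrow> y \<in> A \<Longrightarrow> st (x + y) = st x + st y"
    and st_scaleC: "x \<in> A \<Longrightarrow> st (c *\<^sub>C x) = cnj c *\<^sub>C st x"
    and st_mul: "x \<in> A \<Longrightarrow> y \<in> A \<Longrightarrow> st (x \<odot> y) = st y \<odot> st x"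
    and st_st: "x \<in> A \<Longrightarrow> st (st x) = x"
begin

lemma mul_zero_left [simp]: "0 \<odot> x = 0"
  using mul_add_left[of 0 0 x] by simp

lemma mul_zero_right [simp]: "x \<odot> 0 = 0"
  using mul_add_right[of x 0 0] by simp

lemma zero_mem: "0 \<in> A"
  using scaleC_mem[OF unit_mem, of 0] by simp

lemma minus_mem: "x \<in> A \<Longrightarrow> - x \<in> A"
  using scaleC_mem[of x "- 1"] by (simp add: scaleC_minus_left scaleC_one)

lemma diff_mem: "x \<in> A \<Longrightarrow> y \<in> A \<Longrightarrow> x - y \<in> A"
  using add_mem[of x "- y"] minus_mem[of y] by simp

lemma mul_minus_left: "(- x) \<odot> y = - (x \<odot> y)"
  using mul_add_left[of "- x" x y] by (simp add: eq_neg_iff_add_eq_0)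

lemma mul_minus_right: "y \<odot> (- x) = - (y \<odot> x)"
  using mul_add_right[of y "- x" x] by (simp add: eq_neg_iff_add_eq_0)

lemma mul_diff_left: "(x - y) \<odot> z = x \<odot> z - y \<odot> z"
  using mul_add_left[of x "- y" z] by (simp add: mul_minus_left)

lemma mul_diff_right: "z \<odot> (x - y) = z \<odot> x - z \<odot> y"
  using mul_add_right[of z x "- y"] by (simp add: mul_minus_right)

lemma st_zero: "st 0 = 0"
  using st_scaleC[OF unit_mem, of 0] by simp

lemma st_unit: "st e = e"
  using st_mul[OF st_mem[OF unit_mem] unit_mem] by (simp add: unit_left unit_right st_st[OF unit_mem])

lemma st_minus: "x \<in> A \<Longrightarrow> st (- x) = - st x"
  using st_scaleC[of x "- 1"] by (simp add: scaleC_minus_left scaleC_one)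

lemma st_diff: "x \<in> A \<Longrightarrow> y \<in> A \<Longrightarrow> st (x - y) = st x - st y"
  using st_add[of x "- y"] by (simp add: minus_mem st_minus)

lemmas mem = unit_mem add_mem scaleC_mem mul_mem st_mem zero_mem minus_mem diff_mem

definition peirce :: "'a \<Rightarrow> 'a \<Rightarrow> bool" where
  "peirce P Q \<longleftrightarrow> P \<in> A \<and> Q \<in> A \<and> P \<odot> P = P \<and> Q \<odot> Q = Q \<and> P \<odot> Q = 0 \<and> Q \<odot> P = 0 \<and>
     P + Q = e \<and> st P = P \<and> st Q = Q"

lemma peirce_sym: "peirce P Q \<Longrightarrow> peirce Q P"
  by (auto simp: peirce_def add.commute)

lemma peirce_projection:
  assumes "P \<in> A" "P \<odot> P = P" "st P = P"
  shows "peirce P (e - P)"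
  using assms unfolding peirce_def
  by (simp add: mem mul_diff_left mul_diff_right unit_left unit_right st_diff st_unit)

definition corner :: "'a \<Rightarrow> 'a \<Rightarrow> 'a set" where
  "corner P Q = {x \<in> A. P \<odot> x = x \<and> x \<odot> Q = x}"

lemma corner_mem: "x \<in> corner P Q \<Longrightarrow> x \<in> A"
  by (simp add: corner_def)

lemma corner_add: "x \<in> corner P Q \<Longrightarrow> y \<in> corner P Q \<Longrightarrow> x + y \<in> corner P Q"
  by (simp add: corner_def mem mul_add_left mul_add_right)

lemma corner_scaleC: "P \<in> A \<Longrightarrow> x \<in> corner P Q \<Longrightarrow> c *\<^sub>C x \<in> corner P Q"
  by (simp add: corner_def mem mul_scaleC_left mul_scaleC_right)

lemma corner_compress:
  "P \<in> A \<Longrightarrow> Q \<in> A \<Longrightarrow> P \<odot> P = P \<Longrightarrow> Q \<odot> Q = Q \<Longrightarrow> x \<in> A \<Longrightarrow> P \<odot> x \<odot> Q \<in> corner P Q"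
  unfolding corner_def by (simp add: mem mul_assoc) (simp add: mul_assoc[symmetric])

lemma corner_left_kill: "x \<in> corner P Q \<Longrightarrow> R \<odot> P = 0 \<Longrightarrow> R \<odot> x = 0"
  unfolding corner_def using mul_assoc[of R P x] by auto

lemma corner_right_kill: "x \<in> corner P Q \<Longrightarrow> Q \<odot> R = 0 \<Longrightarrow> x \<odot> R = 0"
  unfolding corner_def using mul_assoc[of x Q R] by auto

lemma corner_st:
  "P \<in> A \<Longrightarrow> Q \<in> A \<Longrightarrow> st P = P \<Longrightarrow> st Q = Q \<Longrightarrow> x \<in> corner P Q \<Longrightarrow> st x \<in> corner Q P"
  unfolding corner_def using st_mul[of P x] st_mul[of x Q] by (auto simp: mem)

lemma peirce_decomp:
  assumes "peirce P Q"
  shows "x = P \<odot> x \<odot> P + (P \<odot> x \<odot> Q + Q \<odot> x \<odot> P) + Q \<odot> x \<odot> Q"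
proof -
  have "x = (P + Q) \<odot> x \<odot> (P + Q)"
    using assms by (simp add: peirce_def unit_left unit_right)
  then show ?thesis by (simp add: mul_add_left mul_add_right algebra_simps)
qed

end

section \<open>Additivity of Jordan \<open>*\<close>-morphisms up to a defect\<close>

text \<open>The target enters only through the biadditive \<open>G\<close>. The numbers
  \<open>\<alpha>\<close>, \<open>\<beta>\<close> and \<open>\<alpha> + \<beta>\<close> are the
  scalars by which a projection acts on the Peirce corners under \<open>F\<close>;
  \<open>\<alpha> + cnj \<beta>\<close> governs the probe that kills one off-diagonal
  corner.\<close>

locale jordan_star_morphism = unital_star_subalgebra A mul st e
  for A :: "'a::complex_vector set" and mul (infixl "\<odot>" 70) and st e +
  fixes \<phi> :: "'a \<Rightarrow> 'b::ab_group_add"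
    and G :: "'b \<Rightarrow> 'b \<Rightarrow> 'b"
    and \<alpha> \<beta> :: complex
  assumes bij: "bij_betw \<phi> A UNIV"
    and G_add_left: "G (u + v) w = G u w + G v w"
    and G_add_right: "G w (u + v) = G w u + G w v"
    and morphism: "x \<in> A \<Longrightarrow> y \<in> A \<Longrightarrow>
      \<phi> (\<alpha> *\<^sub>C (x \<odot> y) + \<beta> *\<^sub>C (y \<odot> st x)) = G (\<phi> x) (\<phi> y)"
    and \<alpha>_nz: "\<alpha> \<noteq> 0" and \<beta>_nz: "\<beta> \<noteq> 0"
    and \<alpha>\<beta>_nz: "\<alpha> + \<beta> \<noteq> 0" and \<alpha>\<beta>_cnj_nz: "\<alpha> + cnj \<beta> \<noteq> 0"
begin

definition F :: "'a \<Rightarrow> 'a \<Rightarrow> 'a" where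
  "F x y = \<alpha> *\<^sub>C (x \<odot> y) + \<beta> *\<^sub>C (y \<odot> st x)"

lemma F_mem: "x \<in> A \<Longrightarrow> y \<in> A \<Longrightarrow> F x y \<in> A"
  by (simp add: F_def mem)

lemma \<phi>_F: "x \<in> A \<Longrightarrow> y \<in> A \<Longrightarrow> \<phi> (F x y) = G (\<phi> x) (\<phi> y)"
  by (simp add: F_def morphism)

lemma F_add_right: "F x (y + z) = F x y + F x z"
  by (simp add: F_def mul_add_left mul_add_right scaleC_add_right)

lemma F_add_left: "x \<in> A \<Longrightarrow> y \<in> A \<Longrightarrow> F (x + y) z = F x z + F y z"
  by (simp add: F_def mul_add_left mul_add_right scaleC_add_right st_add)

lemma F_zero_right: "F x 0 = 0"
  by (simp add: F_def)

lemma \<phi>_inj: "x \<in> A \<Longrightarrow> y \<in> A \<Longrightarrow> \<phi> x = \<phi> y \<Longrightarrow> x = y"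
  using bij by (auto simp: bij_betw_def inj_on_def)

lemma \<phi>_surj: obtains x where "x \<in> A" "\<phi> x = u"
  using bij unfolding bij_betw_def by (metis UNIV_I imageE)

lemma \<phi>_zero: "\<phi> 0 = 0"
proof -
  \<comment> \<open>The preimage of zero makes \<open>G (\<phi> z)\<close> the zero map, by
    additivity in the first variable.\<close>
  obtain z where z: "z \<in> A" "\<phi> z = 0" by (rule \<phi>_surj)
  have "\<phi> (F z 0) = G 0 (\<phi> 0)" using z zero_mem by (simp add: \<phi>_F)
  then show ?thesis using G_add_left[of 0 0 "\<phi> 0"] by (simp add: F_zero_right)
qed

definition additive_at :: "'a \<Rightarrow> 'a \<Rightarrow> bool" where
  "additive_at x y \<longleftrightarrow> \<phi> (x + y) = \<phi> x + \<phi> y"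

lemma additive_zero [simp]: "additive_at 0 x" "additive_at x 0"
  by (simp_all add: additive_at_def \<phi>_zero)

lemma additive_sym: "additive_at x y \<Longrightarrow> additive_at y x"
  by (simp add: additive_at_def add.commute)

lemma F_right_sum:
  assumes "x \<in> A" "y \<in> A" "t \<in> A" "z \<in> A" "\<phi> t = \<phi> x + \<phi> y" "additive_at (F z x) (F z y)"
  shows "F z t = F z (x + y)"
proof (rule \<phi>_inj)
  show "\<phi> (F z t) = \<phi> (F z (x + y))"
    using assms by (simp add: \<phi>_F G_add_right F_add_right additive_at_def)
qed (use assms in \<open>simp_all add: F_mem mem\<close>)

lemma F_left_sum:
  assumes "x \<in> A" "y \<in> A" "t \<in> A" "z \<in> A" "\<phi> t = \<phi> x + \<phi> y" "additive_at (F x z) (F y z)"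
  shows "F t z = F (x + y) z"
proof (rule \<phi>_inj)
  show "\<phi> (F t z) = \<phi> (F (x + y) z)"
    using assms by (simp add: \<phi>_F G_add_left F_add_left additive_at_def)
qed (use assms in \<open>simp_all add: F_mem mem\<close>)

text \<open>\<open>E\<close> absorbs \<open>y\<close> from the left term, and the adjoint of
  \<open>E' y = d E'\<close> absorbs \<open>st y\<close> from the right one. The element
  \<open>x\<close> is arbitrary, so this applies to a defect whose corners are not yet
  known.\<close>

lemma F_compress:
  assumes "E' \<in> A" "E \<in> A" "y \<in> A" "x \<in> A" "st E' = E'"
    and "E \<odot> y = c *\<^sub>C E" "E' \<odot> y = d *\<^sub>C E'"
  shows "E \<odot> F y x \<odot> E' = (\<alpha> * c + \<beta> * cnj d) *\<^sub>C (E \<odot> x \<odot> E')"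
proof -
  have "st y \<odot> E' = cnj d *\<^sub>C E'"
    using arg_cong[OF assms(7), of st] assms(1,3,5) by (simp add: st_mul st_scaleC)
  then have 1: "E \<odot> (x \<odot> st y) \<odot> E' = cnj d *\<^sub>C (E \<odot> x \<odot> E')"
    using assms by (simp add: mul_assoc mul_scaleC_right)
  have 2: "E \<odot> (y \<odot> x) \<odot> E' = c *\<^sub>C (E \<odot> x \<odot> E')"
    using assms by (simp add: mul_assoc[symmetric] mul_scaleC_left)
  have "E \<odot> F y x \<odot> E' = \<alpha> *\<^sub>C (E \<odot> (y \<odot> x) \<odot> E') + \<beta> *\<^sub>C (E \<odot> (x \<odot> st y) \<odot> E')"
    using assms by (simp add: F_def mul_add_right mul_add_left mul_scaleC_left mul_scaleC_right)
  then show ?thesis unfolding 1 2 by (simp add: scaleC_scaleC scaleC_add_left)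
qed

lemma F_corner:
  assumes "E' \<in> A" "E \<in> A" "y \<in> A" "st E' = E'"
    and "E \<odot> y = c *\<^sub>C E" "E' \<odot> y = d *\<^sub>C E'" "x \<in> corner E E'"
    and "y \<odot> E = c *\<^sub>C E" "E' \<odot> st y = cnj d *\<^sub>C E'"
  shows "F y x = (\<alpha> * c + \<beta> * cnj d) *\<^sub>C x"
proof -
  have x: "x \<in> A" "E \<odot> x = x" "x \<odot> E' = x" using assms by (auto simp: corner_def)
  have "y \<odot> x = c *\<^sub>C x"
    using mul_assoc[of y E x] assms x by (simp add: mul_scaleC_left)
  moreover have "x \<odot> st y = cnj d *\<^sub>C x"
    using mul_assoc[of x E' "st y"] assms x by (simp add: mul_scaleC_right)
  ultimately show ?thesis by (simp add: F_def scaleC_scaleC scaleC_add_left)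
qed

section \<open>Probing defects with diagonal elements of a fixed Peirce pair\<close>

context
  fixes P Q
  assumes pq: "peirce P Q"
begin

lemma pq_simps:
  "P \<in> A" "Q \<in> A" "P \<odot> P = P" "Q \<odot> Q = Q" "P \<odot> Q = 0" "Q \<odot> P = 0" "st P = P" "st Q = Q"
  using pq by (auto simp: peirce_def)

text \<open>The probes. Two free parameters suffice to switch off a chosen corner, since a corner is
  scaled by \<open>\<alpha> a + \<beta> cnj b\<close> with \<open>a\<close>, \<open>b\<close> taken
  from \<open>c\<close>, \<open>d\<close>.\<close>

definition diag :: "complex \<Rightarrow> complex \<Rightarrow> 'a" where
  "diag c d = c *\<^sub>C P + d *\<^sub>C Q"

lemma diag_simps:
  "diag c d \<in> A" "st (diag c d) = diag (cnj c) (cnj d)"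
  "P \<odot> diag c d = c *\<^sub>C P" "Q \<odot> diag c d = d *\<^sub>C Q"
  "diag c d \<odot> P = c *\<^sub>C P" "diag c d \<odot> Q = d *\<^sub>C Q"
  by (simp_all add: diag_def pq_simps mem st_add st_scaleC mul_add_left mul_add_right
      mul_scaleC_left mul_scaleC_right)

lemma F_diag:
  "x \<in> corner P P \<Longrightarrow> F (diag c d) x = (\<alpha> * c + \<beta> * cnj c) *\<^sub>C x"
  "x \<in> corner P Q \<Longrightarrow> F (diag c d) x = (\<alpha> * c + \<beta> * cnj d) *\<^sub>C x"
  "x \<in> corner Q P \<Longrightarrow> F (diag c d) x = (\<alpha> * d + \<beta> * cnj c) *\<^sub>C x"
  "x \<in> corner Q Q \<Longrightarrow> F (diag c d) x = (\<alpha> * d + \<beta> * cnj d) *\<^sub>C x"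
proof -
  show "x \<in> corner P P \<Longrightarrow> F (diag c d) x = (\<alpha> * c + \<beta> * cnj c) *\<^sub>C x"
    by (rule F_corner[of P P "diag c d" c c x]) (simp_all add: pq_simps diag_simps)
  show "x \<in> corner P Q \<Longrightarrow> F (diag c d) x = (\<alpha> * c + \<beta> * cnj d) *\<^sub>C x"
    by (rule F_corner[of Q P "diag c d" c d x]) (simp_all add: pq_simps diag_simps)
  show "x \<in> corner Q P \<Longrightarrow> F (diag c d) x = (\<alpha> * d + \<beta> * cnj c) *\<^sub>C x"
    by (rule F_corner[of P Q "diag c d" d c x]) (simp_all add: pq_simps diag_simps)
  show "x \<in> corner Q Q \<Longrightarrow> F (diag c d) x = (\<alpha> * d + \<beta> * cnj d) *\<^sub>C x"
    by (rule F_corner[of Q Q "diag c d" d d x]) (simp_all add: pq_simps diag_simps)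
qed

lemma F_diag_corner:
  "x \<in> corner P P \<Longrightarrow> F (diag c d) x \<in> corner P P"
  "x \<in> corner P Q \<Longrightarrow> F (diag c d) x \<in> corner P Q"
  "x \<in> corner Q P \<Longrightarrow> F (diag c d) x \<in> corner Q P"
  "x \<in> corner Q Q \<Longrightarrow> F (diag c d) x \<in> corner Q Q"
  by (simp_all add: F_diag corner_scaleC pq_simps)

text \<open>Additivity at the probed elements and injectivity of \<open>\<phi>\<close> give
  \<open>F (diag c d) s = 0\<close> for the defect \<open>s\<close>; compressing this to a corner
  leaves a scalar multiple of that corner of \<open>s\<close>.\<close>

lemma corner_defect:
  assumes "x \<in> A" "y \<in> A" "t \<in> A" "\<phi> t = \<phi> x + \<phi> y"
    and "additive_at (F (diag c d) x) (F (diag c d) y)"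
  shows "\<alpha> * c + \<beta> * cnj c \<noteq> 0 \<Longrightarrow> P \<odot> (t - (x + y)) \<odot> P = 0"
    and "\<alpha> * c + \<beta> * cnj d \<noteq> 0 \<Longrightarrow> P \<odot> (t - (x + y)) \<odot> Q = 0"
    and "\<alpha> * d + \<beta> * cnj c \<noteq> 0 \<Longrightarrow> Q \<odot> (t - (x + y)) \<odot> P = 0"
    and "\<alpha> * d + \<beta> * cnj d \<noteq> 0 \<Longrightarrow> Q \<odot> (t - (x + y)) \<odot> Q = 0"
proof -
  have s: "t - (x + y) \<in> A" using assms by (simp add: mem)
  have "F (diag c d) (t - (x + y)) + F (diag c d) (x + y) = F (diag c d) t"
    by (simp flip: F_add_right)
  then have 0: "F (diag c d) (t - (x + y)) = 0"
    using F_right_sum[OF assms(1-3) diag_simps(1) assms(4,5)] by simp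
  have "(\<alpha> * a + \<beta> * cnj b) *\<^sub>C (E \<odot> (t - (x + y)) \<odot> E') = 0"
    if "E' \<in> A" "E \<in> A" "st E' = E'" "E \<odot> diag c d = a *\<^sub>C E" "E' \<odot> diag c d = b *\<^sub>C E'" for E E' a b
    using F_compress[OF that(1,2) diag_simps(1) s that(3-5)] 0 by simp
  note * = this[unfolded scaleC_eq_0_iff]
  show "\<alpha> * c + \<beta> * cnj c \<noteq> 0 \<Longrightarrow> P \<odot> (t - (x + y)) \<odot> P = 0"
    using *[of P P c c] by (simp add: pq_simps diag_simps)
  show "\<alpha> * c + \<beta> * cnj d \<noteq> 0 \<Longrightarrow> P \<odot> (t - (x + y)) \<odot> Q = 0"
    using *[of Q P c d] by (simp add: pq_simps diag_simps)
  show "\<alpha> * d + \<beta> * cnj c \<noteq> 0 \<Longrightarrow> Q \<odot> (t - (x + y)) \<odot> P = 0"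
    using *[of P Q d c] by (simp add: pq_simps diag_simps)
  show "\<alpha> * d + \<beta> * cnj d \<noteq> 0 \<Longrightarrow> Q \<odot> (t - (x + y)) \<odot> Q = 0"
    using *[of Q Q d d] by (simp add: pq_simps diag_simps)
qed

lemma additiveI:
  assumes "\<And>t. t \<in> A \<Longrightarrow> \<phi> t = \<phi> x + \<phi> y \<Longrightarrow>
    P \<odot> (t - (x + y)) \<odot> P = 0 \<and> P \<odot> (t - (x + y)) \<odot> Q = 0 \<and>
    Q \<odot> (t - (x + y)) \<odot> P = 0 \<and> Q \<odot> (t - (x + y)) \<odot> Q = 0"
  shows "additive_at x y"
proof -
  obtain t where t: "t \<in> A" "\<phi> t = \<phi> x + \<phi> y" by (rule \<phi>_surj)
  have "t - (x + y) = 0"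
    using peirce_decomp[OF pq, of "t - (x + y)"] assms[OF t] by simp
  then show ?thesis using t by (simp add: additive_at_def)
qed

text \<open>The choice \<open>Y = \<beta> P - cnj \<alpha> Q\<close> makes \<open>F Y\<close> vanish on the corner \<open>P A Q\<close> and injective on both
  diagonal corners.\<close>

lemma killer_coeffs:
  "\<alpha> * \<beta> + \<beta> * cnj (- cnj \<alpha>) = 0" "\<alpha> * \<beta> + \<beta> * cnj \<beta> \<noteq> 0"
  "\<alpha> * (- cnj \<alpha>) + \<beta> * cnj (- cnj \<alpha>) \<noteq> 0"
proof -
  have "\<alpha> * \<beta> + \<beta> * cnj \<beta> = \<beta> * (\<alpha> + cnj \<beta>)" by (simp add: algebra_simps)
  then show "\<alpha> * \<beta> + \<beta> * cnj \<beta> \<noteq> 0" using \<beta>_nz \<alpha>\<beta>_cnj_nz by simp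
  have "\<alpha> * (- cnj \<alpha>) + \<beta> * cnj (- cnj \<alpha>) = - \<alpha> * cnj (\<alpha> + cnj \<beta>)" by (simp add: algebra_simps)
  then show "\<alpha> * (- cnj \<alpha>) + \<beta> * cnj (- cnj \<alpha>) \<noteq> 0"
    using \<alpha>_nz \<alpha>\<beta>_cnj_nz by (simp del: complex_cnj_add)
qed simp

lemma additive_PQ_QP:
  assumes "x \<in> corner P Q" "y \<in> corner Q P"
  shows "additive_at x y"
proof (rule additiveI)
  fix t assume t: "t \<in> A" "\<phi> t = \<phi> x + \<phi> y"
  have xy: "x \<in> A" "y \<in> A" using assms by (auto intro: corner_mem)
  have "additive_at (F (diag \<beta> (- cnj \<alpha>)) x) (F (diag \<beta> (- cnj \<alpha>)) y)"
    using assms killer_coeffs by (simp add: F_diag del: complex_cnj_minus)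
  note d = corner_defect[OF xy t this]
  have s: "t - (x + y) \<in> A" using xy t by (simp add: mem)
  \<comment> \<open>The probe used so far scales \<open>Q A P\<close> by the difference of the
    squared moduli of \<open>\<beta>\<close> and \<open>\<alpha>\<close>, which is zero if they
    agree. The off-diagonal corners are therefore reached through the first variable of
    \<open>F\<close>: \<open>F x P\<close> and \<open>F y Q\<close> vanish, and multiplying
    \<open>F s R = 0\<close> by \<open>E\<close> from the left removes the term with
    \<open>st s\<close>.\<close>
  have left: "E \<odot> (t - (x + y)) \<odot> R = 0"
    if R: "R \<in> A" "E \<in> A" "E \<odot> R = 0" "F x R = 0 \<or> F y R = 0" "R \<odot> R = R" for E R
  proof -
    have "F (t - (x + y)) R + F (x + y) R = F t R"
      using F_add_left[OF s add_mem[OF xy]] by simp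
    then have "F (t - (x + y)) R = 0"
      using F_left_sum[OF xy t(1) R(1) t(2)] R(4) by auto
    then have "E \<odot> F (t - (x + y)) R = 0" by simp
    then have "\<alpha> *\<^sub>C (E \<odot> (t - (x + y)) \<odot> R) + \<beta> *\<^sub>C ((E \<odot> R) \<odot> st (t - (x + y))) = 0"
      using R(2) by (simp add: F_def mul_add_right mul_scaleC_right flip: mul_assoc)
    then show ?thesis using R \<alpha>_nz by (simp add: scaleC_eq_0_iff)
  qed
  have "F x P = 0"
    using assms(1) corner_right_kill[OF assms(1), of P] corner_left_kill[OF corner_st[OF _ _ _ _ assms(1)], of P]
    by (simp add: F_def pq_simps)
  moreover have "F y Q = 0"
    using assms(2) corner_right_kill[OF assms(2), of Q] corner_left_kill[OF corner_st[OF _ _ _ _ assms(2)], of Q]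
    by (simp add: F_def pq_simps)
  ultimately have "Q \<odot> (t - (x + y)) \<odot> P = 0" "P \<odot> (t - (x + y)) \<odot> Q = 0"
    using left[of P Q] left[of Q P] by (auto simp: pq_simps)
  then show "P \<odot> (t - (x + y)) \<odot> P = 0 \<and> P \<odot> (t - (x + y)) \<odot> Q = 0 \<and>
    Q \<odot> (t - (x + y)) \<odot> P = 0 \<and> Q \<odot> (t - (x + y)) \<odot> Q = 0"
    using d killer_coeffs by blast
qed

text \<open>Two complementary probes: the first kills \<open>y\<close> and sees both diagonal
  corners, while \<open>diag 0 1\<close> kills \<open>x\<close> and sees every corner except
  \<open>P A P\<close>.\<close>

lemma additive_PP_PQ:
  assumes "x \<in> corner P P" "y \<in> corner P Q"
  shows "additive_at x y"
proof (rule additiveI)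
  fix t assume t: "t \<in> A" "\<phi> t = \<phi> x + \<phi> y"
  have xy: "x \<in> A" "y \<in> A" using assms by (auto intro: corner_mem)
  have "additive_at (F (diag \<beta> (- cnj \<alpha>)) x) (F (diag \<beta> (- cnj \<alpha>)) y)"
    using assms killer_coeffs by (simp add: F_diag del: complex_cnj_minus)
  note d1 = corner_defect[OF xy t this]
  have "additive_at (F (diag 0 1) x) (F (diag 0 1) y)"
    using assms by (simp add: F_diag)
  note d2 = corner_defect[OF xy t this]
  show "P \<odot> (t - (x + y)) \<odot> P = 0 \<and> P \<odot> (t - (x + y)) \<odot> Q = 0 \<and>
    Q \<odot> (t - (x + y)) \<odot> P = 0 \<and> Q \<odot> (t - (x + y)) \<odot> Q = 0"
    using d1 d2 killer_coeffs \<alpha>_nz \<beta>_nz \<alpha>\<beta>_nz by auto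
qed

lemma additive_PP_QP:
  assumes "x \<in> corner P P" "y \<in> corner Q P"
  shows "additive_at x y"
proof (rule additiveI)
  fix t assume t: "t \<in> A" "\<phi> t = \<phi> x + \<phi> y"
  have xy: "x \<in> A" "y \<in> A" using assms by (auto intro: corner_mem)
  \<comment> \<open>Exchanging the two parameters moves the vanishing scalar from
    \<open>P A Q\<close> to \<open>Q A P\<close>.\<close>
  have "additive_at (F (diag (- cnj \<alpha>) \<beta>) x) (F (diag (- cnj \<alpha>) \<beta>) y)"
    using assms killer_coeffs by (simp add: F_diag del: complex_cnj_minus)
  note d1 = corner_defect[OF xy t this]
  have "additive_at (F (diag 0 1) x) (F (diag 0 1) y)"
    using assms by (simp add: F_diag)
  note d2 = corner_defect[OF xy t this]
  show "P \<odot> (t - (x + y)) \<odot> P = 0 \<and> P \<odot> (t - (x + y)) \<odot> Q = 0 \<and>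
    Q \<odot> (t - (x + y)) \<odot> P = 0 \<and> Q \<odot> (t - (x + y)) \<odot> Q = 0"
    using d1 d2 killer_coeffs \<alpha>_nz \<beta>_nz \<alpha>\<beta>_nz by auto
qed

text \<open>The probe that kills \<open>P A Q\<close> reduces the off-diagonal sum to its
  \<open>Q A P\<close> part, which \<open>additive_PP_QP\<close> handles.\<close>

lemma additive_PP_off:
  assumes "x \<in> corner P P" "y \<in> corner P Q" "z \<in> corner Q P"
  shows "additive_at x (y + z)"
proof (rule additiveI)
  fix t assume t: "t \<in> A" "\<phi> t = \<phi> x + \<phi> (y + z)"
  have xy: "x \<in> A" "y + z \<in> A" using assms by (auto intro: corner_mem mem)
  have "F (diag \<beta> (- cnj \<alpha>)) (y + z) = F (diag \<beta> (- cnj \<alpha>)) z"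
    using assms killer_coeffs by (simp add: F_add_right F_diag(2) del: complex_cnj_minus)
  then have "additive_at (F (diag \<beta> (- cnj \<alpha>)) x) (F (diag \<beta> (- cnj \<alpha>)) (y + z))"
    using assms by (simp add: additive_PP_QP F_diag_corner)
  note d1 = corner_defect[OF xy t this]
  have "additive_at (F (diag 0 1) x) (F (diag 0 1) (y + z))"
    using assms by (simp add: F_diag)
  note d2 = corner_defect[OF xy t this]
  show "P \<odot> (t - (x + (y + z))) \<odot> P = 0 \<and> P \<odot> (t - (x + (y + z))) \<odot> Q = 0 \<and>
    Q \<odot> (t - (x + (y + z))) \<odot> P = 0 \<and> Q \<odot> (t - (x + (y + z))) \<odot> Q = 0"
    using d1 d2 killer_coeffs \<alpha>_nz \<beta>_nz \<alpha>\<beta>_nz by auto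
qed

end

section \<open>Recombining the corners and summing inside one corner\<close>

lemma \<phi>_corners:
  assumes "peirce P Q" "x \<in> corner P P" "y \<in> corner P Q" "z \<in> corner Q P" "w \<in> corner Q Q"
  shows "\<phi> (x + (y + z) + w) = \<phi> x + (\<phi> y + \<phi> z) + \<phi> w"
proof -
  note pq = assms(1) and qp = peirce_sym[OF assms(1)]
  have "additive_at (x + (y + z)) w"
  proof (rule additiveI[OF pq])
    fix t assume t: "t \<in> A" "\<phi> t = \<phi> (x + (y + z)) + \<phi> w"
    have xy: "x + (y + z) \<in> A" "w \<in> A" using assms by (auto intro: corner_mem mem)
    have "additive_at (F (diag P Q 1 0) (x + (y + z))) (F (diag P Q 1 0) w)"
      using assms by (simp add: F_diag[OF pq])
    note d1 = corner_defect[OF pq xy t this]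
    have "F (diag P Q 0 1) (x + (y + z)) = F (diag P Q 0 1) z + F (diag P Q 0 1) y"
      using assms by (simp add: F_add_right F_diag(1)[OF pq])
    then have "additive_at (F (diag P Q 0 1) (x + (y + z))) (F (diag P Q 0 1) w)"
      using assms additive_PP_off[OF qp] by (simp add: F_diag_corner[OF pq] additive_sym)
    note d2 = corner_defect[OF pq xy t this]
    show "P \<odot> (t - (x + (y + z) + w)) \<odot> P = 0 \<and> P \<odot> (t - (x + (y + z) + w)) \<odot> Q = 0 \<and>
      Q \<odot> (t - (x + (y + z) + w)) \<odot> P = 0 \<and> Q \<odot> (t - (x + (y + z) + w)) \<odot> Q = 0"
      using d1 d2 \<alpha>_nz \<beta>_nz \<alpha>\<beta>_nz by auto
  qed
  moreover have "additive_at x (y + z)" "additive_at y z"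
    using assms by (auto intro: additive_PP_off additive_PQ_QP)
  ultimately show ?thesis by (simp add: additive_at_def)
qed

text \<open>Evaluate \<open>F (P + u) (Q + v)\<close> once directly and once by biadditivity of \<^term>\<open>G\<close>.\<close>

lemma additive_PQ_PQ:
  assumes pq: "peirce P Q" and "x \<in> corner P Q" "y \<in> corner P Q"
  shows "additive_at x y"
proof -
  note simps = pq_simps[OF pq]
  \<comment> \<open>\<open>F\<close> multiplies the \<open>P A Q\<close> terms of the products below
    by \<open>\<alpha>\<close>; dividing beforehand makes the resulting terms exactly
    \<open>x\<close> and \<open>y\<close>.\<close>
  define u where "u = inverse \<alpha> *\<^sub>C x"
  define v where "v = inverse \<alpha> *\<^sub>C y"
  have u: "u \<in> corner P Q" and v: "v \<in> corner P Q"
    using assms simps by (simp_all add: u_def v_def corner_scaleC)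
  have x: "x = \<alpha> *\<^sub>C u" and y: "y = \<alpha> *\<^sub>C v"
    using \<alpha>_nz by (simp_all add: u_def v_def scaleC_scaleC scaleC_one)
  have su: "st u \<in> corner Q P" using u simps by (simp add: corner_st)
  have mm: "u \<in> A" "v \<in> A" "st u \<in> A" using u v su by (auto intro: corner_mem)
  have uv: "P \<odot> u = u" "u \<odot> Q = u" "P \<odot> v = v" "v \<odot> Q = v" "Q \<odot> st u = st u" "st u \<odot> P = st u"
    using u v su by (auto simp: corner_def)
  have k: "Q \<odot> u = 0" "u \<odot> P = 0" "Q \<odot> v = 0" "v \<odot> P = 0" "P \<odot> st u = 0" "st u \<odot> Q = 0" 
    using u v su simps by (auto intro: corner_left_kill corner_right_kill)
  have uv0: "u \<odot> v = 0" using mul_assoc[of u Q v] uv k by simp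
  have vu: "v \<odot> st u \<in> corner P P"
    using mm uv mul_assoc[of P v "st u"] mul_assoc[of v "st u" P] by (simp add: corner_def mem)
  have c: "\<beta> *\<^sub>C (v \<odot> st u) \<in> corner P P" "\<alpha> *\<^sub>C (v + u) \<in> corner P Q" "\<beta> *\<^sub>C st u \<in> corner Q P"
      "x \<in> corner P Q" "0 \<in> corner Q Q" "0 \<in> corner P P" "\<alpha> *\<^sub>C u \<in> corner P Q"
    using u v su vu simps assms by (auto intro: corner_scaleC corner_add) (auto simp: corner_def mem)
  have F1: "F (P + u) (Q + v) = \<beta> *\<^sub>C (v \<odot> st u) + (\<alpha> *\<^sub>C (v + u) + \<beta> *\<^sub>C st u) + 0"
    using simps mm uv k uv0
    by (simp add: F_def mul_add_left mul_add_right st_add scaleC_add_right algebra_simps)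
  have F2: "F P Q = 0" "F P v = \<alpha> *\<^sub>C v" "F u Q = 0 + (\<alpha> *\<^sub>C u + \<beta> *\<^sub>C st u) + 0" "F u v = \<beta> *\<^sub>C (v \<odot> st u)"
    using simps uv k uv0 by (simp_all add: F_def)
  have "P \<in> corner P P" "Q \<in> corner Q Q"
    using simps by (simp_all add: corner_def)
  then have "additive_at P u" "additive_at Q v"
    using u v additive_PP_PQ[OF pq] additive_PP_QP[OF peirce_sym[OF pq]] by auto
  then have "\<phi> (F (P + u) (Q + v)) = \<phi> (F P Q) + \<phi> (F P v) + \<phi> (F u Q) + \<phi> (F u v)"
    using simps mm by (simp add: \<phi>_F mem additive_at_def G_add_left G_add_right)
  \<comment> \<open>Both evaluations contain the images of \<open>\<beta> v u*\<close> and
    \<open>\<beta> u*\<close>; these cancel and only the \<open>P A Q\<close> terms survive.\<close>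
  then have "\<phi> (\<alpha> *\<^sub>C (v + u)) = \<phi> (\<alpha> *\<^sub>C v) + \<phi> (\<alpha> *\<^sub>C u)"
    unfolding F1 F2 \<phi>_corners[OF pq c(1-3,5)] \<phi>_corners[OF pq c(6,7,3,5)] \<phi>_zero by simp
  then show ?thesis by (simp add: x y additive_at_def scaleC_add_right add.commute)
qed

text \<open>\<open>diag 0 1\<close> kills both terms and confines the defect to
  \<open>P A P\<close>. For \<open>z\<close> in \<open>P A Q\<close> and \<open>w\<close> in
  \<open>P A P\<close>, \<open>F w z\<close> reduces to \<open>\<alpha> w z\<close>, again in
  \<open>P A Q\<close>, where \<open>additive_PQ_PQ\<close> applies.\<close>

lemma additive_PP_PP:
  assumes pq: "peirce P Q" and xy: "x \<in> corner P P" "y \<in> corner P P"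
  obtains t where "t \<in> corner P P" "\<phi> t = \<phi> x + \<phi> y"
    "\<And>z. z \<in> corner P Q \<Longrightarrow> (t - (x + y)) \<odot> z = 0"
proof -
  note simps = pq_simps[OF pq]
  obtain t where t: "t \<in> A" "\<phi> t = \<phi> x + \<phi> y" by (rule \<phi>_surj)
  have m: "x \<in> A" "y \<in> A" using xy by (auto intro: corner_mem)
  have "additive_at (F (diag P Q 0 1) x) (F (diag P Q 0 1) y)"
    using xy by (simp add: F_diag[OF pq])
  note d = corner_defect[OF pq m t this]
  have "t - (x + y) = P \<odot> (t - (x + y)) \<odot> P"
    using peirce_decomp[OF pq, of "t - (x + y)"] d \<alpha>_nz \<beta>_nz \<alpha>\<beta>_nz by simp
  then have "t - (x + y) \<in> corner P P"
    using corner_compress[OF simps(1,1,3,3), of "t - (x + y)"] t m by (simp add: mem)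
  from corner_add[OF this corner_add[OF xy]] have tc: "t \<in> corner P P" by simp
  have "(t - (x + y)) \<odot> z = 0" if z: "z \<in> corner P Q" for z
  proof -
    have zA: "z \<in> A" using z by (rule corner_mem)
    have Fz: "F w z = \<alpha> *\<^sub>C (w \<odot> z)" "F w z \<in> corner P Q" if w: "w \<in> corner P P" for w
    proof -
      have "z \<odot> st w = 0"
        using corner_right_kill[OF z simps(6)] mul_assoc[of z P "st w"]
          corner_st[OF simps(1,1,7,7) w] by (auto simp: corner_def)
      then show *: "F w z = \<alpha> *\<^sub>C (w \<odot> z)" by (simp add: F_def)
      show "F w z \<in> corner P Q" unfolding *
        using w z mul_assoc[of P w z] mul_assoc[of w z Q] simps
        by (intro corner_scaleC) (auto simp: corner_def mem)
    qed
    have "F t z = F (x + y) z"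
      using xy Fz(2) by (intro F_left_sum m t zA additive_PQ_PQ[OF pq])
    then have "\<alpha> *\<^sub>C ((t - (x + y)) \<odot> z) = 0"
      using xy tc by (simp add: Fz(1) corner_add mul_diff_left scaleC_diff_right)
    then show ?thesis using \<alpha>_nz by (simp add: scaleC_eq_0_iff)
  qed
  with tc t show ?thesis by (intro that)
qed

text \<open>Split \<open>\<phi> x\<close> and \<open>\<phi> y\<close> by
  \<open>\<phi>_corners\<close>, add corner by corner, and reassemble; injectivity identifies
  \<open>t\<close> with the result. Only the diagonal corners of \<open>t\<close> can then differ
  from those of \<open>x + y\<close>.\<close>

lemma defect_corners:
  assumes pq: "peirce P Q" and x: "x \<in> A" and y: "y \<in> A" and t: "t \<in> A" "\<phi> t = \<phi> x + \<phi> y"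
    and z: "z \<in> A"
  shows "P \<odot> (t - (x + y)) \<odot> Q = 0" "Q \<odot> (t - (x + y)) \<odot> P = 0"
    and "(t - (x + y)) \<odot> (P \<odot> z \<odot> Q) = 0"
proof -
  note simps = pq_simps[OF pq] and qp = peirce_sym[OF pq]
  have cc: "P \<odot> w \<odot> P \<in> corner P P" "P \<odot> w \<odot> Q \<in> corner P Q" "Q \<odot> w \<odot> P \<in> corner Q P"
    "Q \<odot> w \<odot> Q \<in> corner Q Q" if "w \<in> A" for w
    using that simps by (auto intro: corner_compress)
  obtain a where a: "a \<in> corner P P" "\<phi> a = \<phi> (P \<odot> x \<odot> P) + \<phi> (P \<odot> y \<odot> P)"
     "\<And>z. z \<in> corner P Q \<Longrightarrow> (a - (P \<odot> x \<odot> P + P \<odot> y \<odot> P)) \<odot> z = 0"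
    using additive_PP_PP[OF pq cc(1)[OF x] cc(1)[OF y]] by blast
  obtain b where b: "b \<in> corner Q Q" "\<phi> b = \<phi> (Q \<odot> x \<odot> Q) + \<phi> (Q \<odot> y \<odot> Q)"
    using additive_PP_PP[OF qp cc(4)[OF x] cc(4)[OF y]] by blast
  define c where "c = P \<odot> x \<odot> Q + P \<odot> y \<odot> Q"
  define d where "d = Q \<odot> x \<odot> P + Q \<odot> y \<odot> P"
  have c: "c \<in> corner P Q" "\<phi> c = \<phi> (P \<odot> x \<odot> Q) + \<phi> (P \<odot> y \<odot> Q)"
    using cc x y additive_PQ_PQ[OF pq] by (auto simp: c_def corner_add additive_at_def)
  have d: "d \<in> corner Q P" "\<phi> d = \<phi> (Q \<odot> x \<odot> P) + \<phi> (Q \<odot> y \<odot> P)"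
    using cc x y additive_PQ_PQ[OF qp] by (auto simp: d_def corner_add additive_at_def)
  have split: "\<phi> w = \<phi> (P \<odot> w \<odot> P) + (\<phi> (P \<odot> w \<odot> Q) + \<phi> (Q \<odot> w \<odot> P)) + \<phi> (Q \<odot> w \<odot> Q)" if "w \<in> A" for w
    using \<phi>_corners[OF pq cc[OF that]] peirce_decomp[OF pq, of w] by simp
  have "\<phi> (a + (c + d) + b) = \<phi> t"
    unfolding \<phi>_corners[OF pq a(1) c(1) d(1) b(1)] t(2) split[OF x] split[OF y] a(2) b(2) c(2) d(2)
    by (simp add: algebra_simps)
  then have T: "t = a + (c + d) + b"
    using a b c d t by (intro \<phi>_inj) (auto intro: mem corner_mem)
  have ac: "P \<odot> a = a" "a \<odot> P = a" "P \<odot> c = c" "c \<odot> Q = c" "Q \<odot> d = d" "d \<odot> P = d" "Q \<odot> b = b" "b \<odot> Q = b"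
    using a b c d by (auto simp: corner_def)
  have k: "Q \<odot> a = 0" "a \<odot> Q = 0" "Q \<odot> c = 0" "c \<odot> P = 0" "P \<odot> d = 0" "d \<odot> Q = 0" "P \<odot> b = 0" "b \<odot> P = 0"
    using a b c d simps by (auto intro: corner_left_kill corner_right_kill)
  show PQ: "P \<odot> (t - (x + y)) \<odot> Q = 0"
    using ac k by (simp add: T mul_diff_left mul_diff_right mul_add_left mul_add_right c_def)
  show QP: "Q \<odot> (t - (x + y)) \<odot> P = 0"
    using ac k by (simp add: T mul_diff_left mul_diff_right mul_add_left mul_add_right d_def)
  have "(t - (x + y)) \<odot> P = P \<odot> (t - (x + y)) \<odot> P"
    using QP mul_add_left[of P Q "(t - (x + y)) \<odot> P"] pq
    by (simp add: peirce_def unit_left mul_assoc)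
  also have "\<dots> = a - (P \<odot> x \<odot> P + P \<odot> y \<odot> P)"
    using ac k by (simp add: T mul_diff_left mul_diff_right mul_add_left mul_add_right)
  finally have "(t - (x + y)) \<odot> P \<odot> (P \<odot> z \<odot> Q) = 0"
    using a(3)[OF cc(2)[OF z]] by simp
  moreover have "P \<odot> (P \<odot> z \<odot> Q) = P \<odot> z \<odot> Q"
    using cc(2)[OF z] by (auto simp: corner_def)
  ultimately show "(t - (x + y)) \<odot> (P \<odot> z \<odot> Q) = 0" by (simp add: mul_assoc)
qed

lemma defect_projection:
  assumes P: "P \<in> A" "P \<odot> P = P" "st P = P"
    and x: "x \<in> A" and y: "y \<in> A" and t: "t \<in> A" "\<phi> t = \<phi> x + \<phi> y" and z: "z \<in> A"
  shows "(t - (x + y)) \<odot> P = P \<odot> (t - (x + y))"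
    and "(t - (x + y)) \<odot> (P \<odot> z - z \<odot> P) = 0"
proof -
  define s where "s = t - (x + y)"
  note pq = peirce_projection[OF P]
  have d: "P \<odot> s = P \<odot> s \<odot> P" "s \<odot> P = P \<odot> s \<odot> P"
    using defect_corners(1,2)[OF pq x y t z]
    by (simp_all add: s_def[symmetric] mul_diff_left mul_diff_right unit_left unit_right)
  then show "(t - (x + y)) \<odot> P = P \<odot> (t - (x + y))" by (simp add: s_def)
  \<comment> \<open>The difference of these two products is \<open>s (P z - z P)\<close>, since the
    terms \<open>P z P\<close> cancel.\<close>
  have "s \<odot> (P \<odot> z \<odot> (e - P)) = 0" "s \<odot> ((e - P) \<odot> z \<odot> P) = 0"
    using defect_corners(3)[OF pq x y t z] defect_corners(3)[OF peirce_sym[OF pq] x y t z]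
    by (simp_all add: s_def)
  then show "(t - (x + y)) \<odot> (P \<odot> z - z \<odot> P) = 0"
    by (simp add: s_def[symmetric] mul_diff_left mul_diff_right unit_left unit_right mul_assoc)
qed

end

section \<open>Projections in a von Neumann algebra\<close>

lemma adj_eqI:
  fixes S T :: "'h::complex_hilbert_space \<Rightarrow>\<^sub>L 'h"
  assumes "T \<in> clinear_ops" "\<And>x y. cinner (T x) y = cinner x (S y)"
  shows "adj T = S"
proof (rule blinfun_eqI)
  show "adj T y = S y" for y
    by (rule cinner_eqI) (simp add: assms(2) flip: cinner_adj[OF assms(1)])
qed

lemma cinner_adj_left: "T \<in> clinear_ops \<Longrightarrow> cinner (adj T x) y = cinner x (T y)"
  using cinner_adj[of T y x] by (metis cinner_commute)

lemma cinner_zero_right [simp]: "cinner x 0 = 0"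
  using cinner_diff_right[of x 0 0] by simp

lemma norm_diff_sq:
  "(norm (x - y))\<^sup>2 = (norm x)\<^sup>2 - 2 * Re (cinner x y) + (norm (y::'h::complex_hilbert_space))\<^sup>2"
  using norm_add_sq[of x "- y"] cinner_scaleR_right[of x "- 1" y] by simp

lemma abs_Re_cinner_le: "\<bar>Re (cinner x y)\<bar> \<le> norm x * norm y"
  using Re_cinner_le[of x y] Re_cinner_le[of "(- 1) *\<^sub>R x" y] unfolding cinner_scaleR_left by auto

text \<open>A crude bound from the real and imaginary parts; it serves only for continuity, so the
  factor 2 is harmless.\<close>

lemma cmod_cinner_le: "cmod (cinner x y) \<le> norm x * (2 * norm y)"
proof -
  have "\<bar>Im (cinner x y)\<bar> \<le> norm x * norm y"
    using abs_Re_cinner_le[of "\<i> *\<^sub>C x" y] by (simp add: cinner_scaleC_left norm_scaleC)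
  then show ?thesis
    using abs_Re_cinner_le[of x y] cmod_le[of "cinner x y"] by simp
qed

lemma bounded_linear_cinner_left: "bounded_linear (\<lambda>x. cinner x y)"
  by (rule bounded_linear_intro[where K = "2 * norm y"])
    (simp_all add: cinner_add_left cinner_scaleR_left cmod_cinner_le scaleR_conv_of_real)

lemmas tendsto_cinner_left = bounded_linear.tendsto[OF bounded_linear_cinner_left]

lemma tendsto_cinner_right: "(f \<longlongrightarrow> l) F \<Longrightarrow> ((\<lambda>n. cinner x (f n)) \<longlongrightarrow> cinner x l) F"
  using tendsto_cnj[OF tendsto_cinner_left[of f l F x]] by (simp flip: cinner_commute)

text \<open>Turns convergence in the product topology behind \<open>weak_operator_topology\<close>
  into convergence of each matrix coefficient.\<close>

lemma tendsto_fun_iff: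
  "(f \<longlongrightarrow> l) F \<longleftrightarrow> (\<forall>i. ((\<lambda>c. f c i) \<longlongrightarrow> l i) F)"
  for f :: "'c \<Rightarrow> 'i \<Rightarrow> 'b::topological_space"
  using limitin_componentwise[of "\<lambda>i::'i. euclidean :: 'b topology" UNIV f l F]
  by (simp add: euclidean_product_topology)

lemma scaleR_blinfun_scaleC:
  "r *\<^sub>R T = complex_of_real r *\<^sub>C (T :: 'a::real_normed_vector \<Rightarrow>\<^sub>L 'h::complex_hilbert_space)"
  by (rule blinfun_eqI) (simp add: scaleR_blinfun.rep_eq scaleC_blinfun.rep_eq scaleR_scaleC)

lemmas blinfun_compose_diff_left = bounded_bilinear.diff_left[OF bounded_bilinear_blinfun_compose]
lemmas blinfun_compose_diff_right = bounded_bilinear.diff_right[OF bounded_bilinear_blinfun_compose]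
lemmas blinfun_compose_scaleR_left = bounded_bilinear.scaleR_left[OF bounded_bilinear_blinfun_compose]
lemmas blinfun_compose_scaleR_right = bounded_bilinear.scaleR_right[OF bounded_bilinear_blinfun_compose]
lemmas blinfun_compose_add_left = bounded_bilinear.add_left[OF bounded_bilinear_blinfun_compose]
lemmas blinfun_compose_add_right = bounded_bilinear.add_right[OF bounded_bilinear_blinfun_compose]
lemmas blinfun_compose_tendsto = bounded_bilinear.tendsto[OF bounded_bilinear_blinfun_compose]

lemmas tendsto_blinfun_apply = bounded_linear.tendsto[OF blinfun.bounded_linear_right]

lemma blinfun_compose_id [simp]: "id_blinfun o\<^sub>L T = T" "T o\<^sub>L id_blinfun = T"
  by (auto intro!: blinfun_eqI)

lemma blinfun_compose_commute_apply:
  "S o\<^sub>L T = T o\<^sub>L S \<Longrightarrow> blinfun_apply S (blinfun_apply T x) = T (S x)"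
  by (metis blinfun_apply_blinfun_compose)

lemma strong_limit_commute:
  fixes S F :: "'a::real_normed_vector \<Rightarrow>\<^sub>L 'a" and T :: "nat \<Rightarrow> 'a \<Rightarrow>\<^sub>L 'a"
  assumes "\<And>x. (\<lambda>n. T n x) \<longlonglongrightarrow> F x" "\<And>n. S o\<^sub>L T n = T n o\<^sub>L S"
  shows "S o\<^sub>L F = F o\<^sub>L S"
proof (rule blinfun_eqI)
  fix x
  have "(\<lambda>n. S (T n x)) \<longlonglongrightarrow> S (F x)"
    by (intro tendsto_blinfun_apply assms(1))
  moreover have "(\<lambda>n. S (T n x)) \<longlonglongrightarrow> F (S x)"
    using assms(1)[of "S x"] blinfun_compose_commute_apply[OF assms(2)] by simp
  ultimately show "(S o\<^sub>L F) x = (F o\<^sub>L S) x" using LIMSEQ_unique by auto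
qed

lemma strong_limit_selfadjoint:
  fixes F :: "'h::complex_hilbert_space \<Rightarrow>\<^sub>L 'h" and T :: "nat \<Rightarrow> 'h \<Rightarrow>\<^sub>L 'h"
  assumes "\<And>x. (\<lambda>n. T n x) \<longlonglongrightarrow> F x" "\<And>n x y. cinner (T n x) y = cinner x (T n y)"
  shows "cinner (F x) y = cinner x (F y)"
  using LIMSEQ_unique[OF tendsto_cinner_left[OF assms(1)] tendsto_cinner_right[OF assms(1), of x y,
        folded assms(2)]] .

locale von_neumann_alg =
  fixes \<A> :: "('h::complex_hilbert_space \<Rightarrow>\<^sub>L 'h) set"
  assumes vN: "von_neumann_algebra \<A>"
begin

notation blinfun_compose  (infixl "\<odot>" 70)

lemma clinear: "T \<in> \<A> \<Longrightarrow> T \<in> clinear_ops"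
  using vN by (auto simp: von_neumann_algebra_def)

lemma adj_mem: "T \<in> \<A> \<Longrightarrow> adj T \<in> \<A>"
  using vN by (auto simp: von_neumann_algebra_def)

lemma cinner_adj': "T \<in> \<A> \<Longrightarrow> cinner (T x) y = cinner x (adj T y)"
  by (simp add: cinner_adj clinear)

lemma adj_eqI': "T \<in> \<A> \<Longrightarrow> (\<And>x y. cinner (T x) y = cinner x (blinfun_apply S y)) \<Longrightarrow> adj T = S"
  by (simp add: adj_eqI clinear)

lemma cinner_selfadjoint: "T \<in> \<A> \<Longrightarrow> adj T = T \<Longrightarrow> cinner (T x) y = cinner x (T y)"
  using cinner_adj'[of T x y] by simp

sublocale unital_star_subalgebra \<A> "(o\<^sub>L)" adj id_blinfun
proof
  fix x y z :: "'h \<Rightarrow>\<^sub>L 'h" and c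
  show "x \<odot> y \<odot> z = x \<odot> (y \<odot> z)" by (rule blinfun_eqI) simp
  show "(x + y) \<odot> z = x \<odot> z + y \<odot> z" by (rule blinfun_compose_add_left)
  show "z \<odot> (x + y) = z \<odot> x + z \<odot> y" by (rule blinfun_compose_add_right)
  show "c *\<^sub>C x \<odot> y = c *\<^sub>C (x \<odot> y)"
    by (rule blinfun_eqI) (simp add: scaleC_blinfun.rep_eq)
  show "id_blinfun \<in> \<A>" using vN by (simp add: von_neumann_algebra_def)
  assume x: "x \<in> \<A>"
  show "x \<odot> c *\<^sub>C y = c *\<^sub>C (x \<odot> y)"
    using clinear[OF x] by (intro blinfun_eqI) (simp add: scaleC_blinfun.rep_eq clinear_ops_def)
  show "c *\<^sub>C x \<in> \<A>" and "adj x \<in> \<A>" using x vN by (simp_all add: von_neumann_algebra_def)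
  then show "adj (c *\<^sub>C x) = cnj c *\<^sub>C adj x"
    using x by (intro adj_eqI')
      (simp_all add: scaleC_blinfun.rep_eq cinner_scaleC_left cinner_scaleC_right cinner_adj')
  show "adj (adj x) = x"
    using x by (intro adj_eqI' adj_mem) (simp_all add: cinner_adj_left clinear)
  assume y: "y \<in> \<A>"
  show "x + y \<in> \<A>" and "x \<odot> y \<in> \<A>" using x y vN by (simp_all add: von_neumann_algebra_def)
  then show "adj (x + y) = adj x + adj y" and "adj (x \<odot> y) = adj y \<odot> adj x"
    using x y by (auto intro!: adj_eqI' simp: blinfun.add_left cinner_add_left cinner_add_right cinner_adj')
qed (auto intro: blinfun_eqI)

lemma scaleR_mem: "T \<in> \<A> \<Longrightarrow> r *\<^sub>R T \<in> \<A>"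
  by (simp add: scaleR_blinfun_scaleC scaleC_mem)

lemma adj_scaleR: "T \<in> \<A> \<Longrightarrow> adj (r *\<^sub>R T) = r *\<^sub>R adj T"
  by (simp add: scaleR_blinfun_scaleC st_scaleC)

text \<open>Strong convergence implies weak operator convergence, and the complement of the algebra
  is the preimage of an open set, which would have to contain some \<open>T n\<close>.\<close>

lemma strong_limit_mem:
  fixes F :: "'h \<Rightarrow>\<^sub>L 'h"
  assumes "\<And>n. T n \<in> \<A>" "\<And>x. (\<lambda>n. T n x) \<longlonglongrightarrow> F x"
  shows "F \<in> \<A>"
proof (rule ccontr)
  assume F: "F \<notin> \<A>"
  define f where "f T = (\<lambda>x y. cinner (blinfun_apply T x) y)" for T :: "'h \<Rightarrow>\<^sub>L 'h"
  have "closedin (pullback_topology UNIV f euclidean) \<A>"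
    using vN unfolding von_neumann_algebra_def weak_operator_topology_def f_def[abs_def] by blast
  then obtain U where U: "open U" "UNIV - \<A> = f -` U"
    unfolding closedin_def openin_pullback_topology topspace_pullback_topology by auto
  have "(\<lambda>n. f (T n)) \<longlonglongrightarrow> f F"
    using assms(2) by (auto simp: f_def tendsto_fun_iff intro: tendsto_cinner_left)
  moreover have "f F \<in> U" using U F by auto
  ultimately have "eventually (\<lambda>n. f (T n) \<in> U) sequentially"
    using U(1) by (auto simp: tendsto_def)
  then obtain n where "f (T n) \<in> U" by (auto simp: eventually_sequentially)
  then show False using U(2) assms(1)[of n] by auto
qed

lemma norm_limit_mem:
  assumes "\<And>n. T n \<in> \<A>" "T \<longlonglongrightarrow> F"
  shows "F \<in> \<A>"
  using strong_limit_mem[OF assms(1) blinfun.tendsto[OF assms(2) tendsto_const]] .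

text \<open>The square root is \<open>I - Y\<close> for the fixed point \<open>Y\<close> of \<open>Y \<mapsto> (X + Y\<^sup>2)/2\<close>. The iteration is dominated by
  its scalar counterpart \<open>r\<close> with \<open>X = 1\<close>, whose monotone convergence forces norm convergence.\<close>

lemma square_root:
  assumes X: "X \<in> \<A>" "adj X = X" "norm X \<le> 1"
  obtains R where "R \<in> \<A>" "adj R = R" "R \<odot> R = id_blinfun - X" "norm (id_blinfun - R) \<le> 1"
    "\<forall>S. S \<odot> X = X \<odot> S \<longrightarrow> S \<odot> R = R \<odot> S"
proof -
  define Y where "Y = rec_nat 0 (\<lambda>_ Z. (1/2) *\<^sub>R (X + Z \<odot> Z))"
  have Y0: "Y 0 = 0" and YS: "Y (Suc k) = (1/2) *\<^sub>R (X + Y k \<odot> Y k)" for k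
    by (simp_all add: Y_def)
  define r where "r = rec_nat 0 (\<lambda>_ s. (1 + s\<^sup>2) / 2 :: real)"
  have r0: "r 0 = 0" and rS: "r (Suc k) = (1 + (r k)\<^sup>2) / 2" for k
    by (simp_all add: r_def)
  have r01: "0 \<le> r k \<and> r k \<le> 1" for k
    by (induction k) (simp_all add: r0 rS power_le_one)
  have nY: "norm (Y k) \<le> r k" for k
  proof (induction k)
    case (Suc k)
    have "norm (Y (Suc k)) \<le> (1/2) * (norm X + norm (Y k \<odot> Y k))"
      unfolding YS by (simp add: norm_triangle_ineq)
    also have "\<dots> \<le> (1/2) * (1 + r k * r k)"
      using X order.trans[OF norm_blinfun_compose[of "Y k" "Y k"] mult_mono[OF Suc Suc]] r01[of k] by simp
    finally show ?case by (simp add: rS power2_eq_square)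
  qed (simp add: Y0 r0)
  have dY: "norm (Y (Suc k) - Y k) \<le> r (Suc k) - r k" for k
  proof (induction k)
    case 0
    show ?case using X by (simp add: YS Y0 rS r0)
  next
    case (Suc k)
    let ?D = "Y (Suc k) - Y k"
    \<comment> \<open>The difference of squares is split as \<open>Y' (Y' - Y) + (Y' - Y) Y\<close>,
      which needs no commutation; the scalar sequence satisfies the same identity.\<close>
    have "Y (Suc (Suc k)) - Y (Suc k) = (1/2) *\<^sub>R (Y (Suc k) \<odot> ?D + ?D \<odot> Y k)"
      unfolding YS[of "Suc k"] YS[of k, THEN arg_cong[where f = "\<lambda>T. U - T" for U]]
      by (simp add: blinfun_compose_diff_left blinfun_compose_diff_right algebra_simps flip: scaleR_diff_right)
    then have "norm (Y (Suc (Suc k)) - Y (Suc k)) = (1/2) * norm (Y (Suc k) \<odot> ?D + ?D \<odot> Y k)"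
      by simp
    also have "\<dots> \<le> (1/2) * (norm (Y (Suc k)) * norm ?D + norm ?D * norm (Y k))"
      by (intro mult_left_mono order.trans[OF norm_triangle_ineq] add_mono norm_blinfun_compose) simp
    also have "\<dots> \<le> (1/2) * (r (Suc k) * (r (Suc k) - r k) + (r (Suc k) - r k) * r k)"
      using r01[of "Suc k"] order.trans[OF norm_ge_zero Suc]
      by (intro mult_left_mono add_mono mult_mono nY Suc) auto
    also have "\<dots> = r (Suc (Suc k)) - r (Suc k)"
      unfolding rS[of "Suc k"] rS[of k, THEN arg_cong[where f = "\<lambda>t. u - t" for u]]
      by (simp add: power2_eq_square field_simps)
    finally show ?case .
  qed
  have dist: "norm (Y (k + m) - Y k) \<le> r (k + m) - r k" for k m
  proof (induction m)
    case (Suc m)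
    have "norm (Y (k + Suc m) - Y k) \<le> norm (Y (Suc (k + m)) - Y (k + m)) + norm (Y (k + m) - Y k)"
      using norm_triangle_ineq[of "Y (Suc (k + m)) - Y (k + m)" "Y (k + m) - Y k"] by simp
    then show ?case using Suc dY[of "k + m"] by simp
  qed simp
  have "incseq r"
    using order.trans[OF norm_ge_zero dY] by (intro incseq_SucI) auto
  then have "convergent r"
    using r01 by (auto intro!: Bseq_monoseq_convergent BseqI'[of _ 1] simp: incseq_imp_monoseq)
  then have rC: "Cauchy r" by (rule convergent_Cauchy)
  have "Cauchy Y"
  proof (rule CauchyI)
    fix \<epsilon> :: real assume "\<epsilon> > 0"
    then obtain M where M: "\<And>m n. m \<ge> M \<Longrightarrow> n \<ge> M \<Longrightarrow> norm (r m - r n) < \<epsilon>"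
      using CauchyD[OF rC] by blast
    have *: "norm (Y m - Y n) < \<epsilon>" if "m \<ge> n" "n \<ge> M" for m n
      using dist[of n "m - n"] M[of m n] that by auto
    show "\<exists>M. \<forall>m\<ge>M. \<forall>n\<ge>M. norm (Y m - Y n) < \<epsilon>"
      using * by (metis nle_le norm_minus_commute)
  qed
  then obtain L where L: "Y \<longlonglongrightarrow> L" using Cauchy_convergent convergent_def by blast
  then have Lx: "(\<lambda>n. Y n x) \<longlonglongrightarrow> L x" for x by (intro blinfun.tendsto tendsto_const)
  have Ymem: "Y k \<in> \<A>" for k
    by (induction k) (simp_all add: Y0 YS mem X scaleR_mem)
  have Yadj: "adj (Y k) = Y k" for k
    by (induction k) (simp_all add: Y0 YS st_zero adj_scaleR mem X Ymem st_add st_mul)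
  have Lmem: "L \<in> \<A>" using norm_limit_mem[OF Ymem L] .
  have "cinner (L x) y = cinner x (L y)" for x y
    using strong_limit_selfadjoint[OF Lx cinner_selfadjoint[OF Ymem Yadj]] .
  then have Ladj: "adj L = L" using Lmem by (rule adj_eqI'[rotated])
  have "(\<lambda>k. Y (Suc k)) \<longlonglongrightarrow> (1/2) *\<^sub>R (X + L \<odot> L)"
    unfolding YS by (intro tendsto_intros blinfun_compose_tendsto L)
  then have "L = (1/2) *\<^sub>R (X + L \<odot> L)"
    using LIMSEQ_Suc[OF L] LIMSEQ_unique by blast
  then have "2 *\<^sub>R L = 2 *\<^sub>R ((1/2) *\<^sub>R (X + L \<odot> L))" by (rule arg_cong)
  \<comment> \<open>Equivalent to \<open>(I - L)(I - L) = I - X\<close>.\<close>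
  then have L2: "L + L = X + L \<odot> L" by (simp add: scaleR_2)
  have nL: "norm L \<le> 1"
    using nY r01 order.trans by (intro LIMSEQ_le_const2[OF tendsto_norm[OF L]]) blast
  show ?thesis
  proof (rule that[of "id_blinfun - L"])
    show "id_blinfun - L \<in> \<A>" and "adj (id_blinfun - L) = id_blinfun - L"
      using Lmem Ladj by (simp_all add: mem st_diff st_unit)
    show "(id_blinfun - L) \<odot> (id_blinfun - L) = id_blinfun - X"
      using L2 by (simp add: blinfun_compose_diff_left blinfun_compose_diff_right algebra_simps)
    show "norm (id_blinfun - (id_blinfun - L)) \<le> 1" using nL by simp
    have "S \<odot> (id_blinfun - L) = (id_blinfun - L) \<odot> S" if S: "S \<odot> X = X \<odot> S" for S
    proof -
      have "S \<odot> Y k = Y k \<odot> S" for k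
      proof (induction k)
        case (Suc k)
        have "S \<odot> (Y k \<odot> Y k) = (Y k \<odot> Y k) \<odot> S"
          using Suc mul_assoc[of S "Y k" "Y k"] mul_assoc[of "Y k" S "Y k"] mul_assoc[of "Y k" "Y k" S] by simp
        then show ?case
          by (simp add: YS S blinfun_compose_scaleR_left blinfun_compose_scaleR_right
              blinfun_compose_add_left blinfun_compose_add_right)
      qed (simp add: Y0)
      then show ?thesis
        using strong_limit_commute[OF Lx] by (simp add: blinfun_compose_diff_left blinfun_compose_diff_right)
    qed
    then show "\<forall>S. S \<odot> X = X \<odot> S \<longrightarrow> S \<odot> (id_blinfun - L) = (id_blinfun - L) \<odot> S" by blast
  qed
qed

text \<open>Self-adjointness turns the inner product of \<open>x\<close> with \<open>D (D x)\<close>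
  into the squared norm of \<open>D x\<close>. For a contraction \<open>D\<close> it follows that
  \<open>I - D D\<close> is a contraction too.\<close>

lemma norm_one_minus_square:
  fixes D :: "'h \<Rightarrow>\<^sub>L 'h"
  assumes "D \<in> \<A>" "adj D = D"
  shows "(norm (x - D (D x)))\<^sup>2 = (norm x)\<^sup>2 - 2 * (norm (D x))\<^sup>2 + (norm (D (D x)))\<^sup>2"
  using cinner_selfadjoint[OF assms, of x "D x"] 
  by (simp add: norm_diff_sq cinner_self flip: cinner_selfadjoint[OF assms])

lemma norm_apply_le: "norm T \<le> 1 \<Longrightarrow> norm (blinfun_apply T x) \<le> norm x"
  using norm_blinfun[of T x] mult_right_mono[of "norm T" 1 "norm x"] by simp

text \<open>The powers \<open>W\<^sup>2\<^sup>n\<close> of \<open>W = I - D\<^sup>2\<close> converge strongly to the projection onto the kernel of \<open>D\<close>: with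
  \<open>a k = \<parallel>W\<^sup>k x\<parallel>\<^sup>2\<close>, which is decreasing, \<open>\<parallel>W\<^sup>2\<^sup>n x - W\<^sup>2\<^sup>m x\<parallel>\<^sup>2 = a (2n) - 2 a (n+m) + a (2m)\<close>.\<close>

lemma kernel_projection_contraction:
  assumes D: "D \<in> \<A>" "adj D = D" "norm D \<le> 1"
  obtains P where "P \<in> \<A>" "P \<odot> P = P" "adj P = P" "D \<odot> P = 0" "\<forall>x. blinfun_apply D x = 0 \<longrightarrow> blinfun_apply P x = x"
    "\<forall>S. S \<odot> D = D \<odot> S \<longrightarrow> S \<odot> P = P \<odot> S"
proof -
  define W where "W = id_blinfun - D \<odot> D"
  have Wx: "W x = x - D (D x)" for x
    by (simp add: W_def blinfun.diff_left)
  have Wmem: "W \<in> \<A>" and Wadj: "adj W = W"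
    using D by (simp_all add: W_def mem st_diff st_unit st_mul)
  note nD = norm_apply_le[OF D(3)]
  have Wsq: "(norm (W x))\<^sup>2 = (norm x)\<^sup>2 - 2 * (norm (D x))\<^sup>2 + (norm (D (D x)))\<^sup>2" for x
    unfolding Wx by (rule norm_one_minus_square[OF D(1,2)])
  have DD: "(norm (D (D x)))\<^sup>2 \<le> (norm (D x))\<^sup>2" for x
    using nD[of "D x"] by (simp add: power_mono)
  have nW: "norm (W x) \<le> norm x" for x
  proof (rule power2_le_imp_le)
    show "(norm (W x))\<^sup>2 \<le> (norm x)\<^sup>2"
      using Wsq[of x] DD[of x] zero_le_power2[of "norm (D x)"] by linarith
  qed simp
  define T where "T = rec_nat id_blinfun (\<lambda>_ Z. W \<odot> Z)"
  have T0: "T 0 = id_blinfun" and TS: "T (Suc n) = W \<odot> T n" for n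
    by (simp_all add: T_def)
  have Tmem: "T n \<in> \<A>" for n by (induction n) (simp_all add: T0 TS mem Wmem)
  have Tadd: "T (n + m) = T n \<odot> T m" for n m
    by (induction n) (simp_all add: T0 TS mul_assoc)
  have Tcomm: "S \<odot> T n = T n \<odot> S" if "S \<odot> W = W \<odot> S" for S n
    by (induction n) (simp_all add: T0 TS, metis mul_assoc that)
  have Tadj: "adj (T n) = T n" for n
    by (induction n) (simp_all add: T0 TS st_unit st_mul Wmem Tmem Wadj Tcomm[OF refl])
  note Tsa = cinner_selfadjoint[OF Tmem Tadj]
  have nT: "norm (T n x) \<le> norm x" for n x
    by (induction n) (auto simp: T0 TS intro: order.trans[OF nW])
  define a where "a x k = (norm (T k x))\<^sup>2" for x k
  \<comment> \<open>Self-adjoint powers can be redistributed evenly when the exponents have an even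
    sum; hence the restriction to even powers of \<open>W\<close>.\<close>
  have inner: "Re (cinner (T i x) (T j x)) = a x k" if "i + j = 2 * k" for i j k x
  proof -
    have "cinner (T i x) (T j x) = cinner (T (i + j) x) x"
      using Tsa[of j "T i x" x] by (simp add: Tadd add.commute[of i j])
    also have "\<dots> = cinner (T k x) (T k x)"
      using Tsa[of k "T k x" x] unfolding that by (simp add: Tadd mult_2)
    finally show ?thesis by (simp add: cinner_self a_def)
  qed
  have Cauchy: "Cauchy (\<lambda>n. T (2 * n) x)" for x
  proof -
    have "decseq (a x)"
      unfolding a_def using nW by (intro decseq_SucI) (simp add: TS power_mono)
    moreover have "0 \<le> a x k" for k by (simp add: a_def)
    ultimately obtain l where l: "a x \<longlonglongrightarrow> l" using decseq_convergent by metis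
    have "Cauchy (a x)" using l convergent_Cauchy convergent_def by blast
    have sq: "(norm (T (2 * n) x - T (2 * m) x))\<^sup>2 = a x (2 * n) - 2 * a x (n + m) + a x (2 * m)" for n m
      using inner[of "2 * n" "2 * m" "n + m" x] by (simp add: norm_diff_sq a_def)
    show ?thesis
    proof (rule CauchyI)
      fix \<epsilon> :: real assume e: "\<epsilon> > 0"
      then obtain M where M: "\<And>m n. m \<ge> M \<Longrightarrow> n \<ge> M \<Longrightarrow> norm (a x m - a x n) < \<epsilon>\<^sup>2 / 2"
        using CauchyD[OF \<open>Cauchy (a x)\<close>, of "\<epsilon>\<^sup>2 / 2"] by auto
      have "norm (T (2 * m) x - T (2 * n) x) < \<epsilon>" if "m \<ge> M" "n \<ge> M" for m n
      proof -
        have "(norm (T (2 * m) x - T (2 * n) x))\<^sup>2 < \<epsilon>\<^sup>2"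
        proof -
          have "norm (a x (2 * m) - a x (m + n)) < \<epsilon>\<^sup>2 / 2" "norm (a x (2 * n) - a x (m + n)) < \<epsilon>\<^sup>2 / 2"
            by (rule M; use that in simp)+
          then show ?thesis unfolding sq real_norm_def by linarith
        qed
        then show ?thesis using e by (simp add: power2_less_imp_less)
      qed
      then show "\<exists>M. \<forall>m\<ge>M. \<forall>n\<ge>M. norm (T (2 * m) x - T (2 * n) x) < \<epsilon>" by blast
    qed
  qed
  have "\<exists>l. (\<lambda>n. T (2 * n) x) \<longlonglongrightarrow> l" for x
    using Cauchy_convergent[OF Cauchy[of x]] unfolding convergent_def .
  then obtain p where p: "\<And>x. (\<lambda>n. T (2 * n) x) \<longlonglongrightarrow> p x" by metis
  have "bounded_linear p"
  proof (rule bounded_linear_intro[where K = 1])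
    show "p (x + y) = p x + p y" for x y
      using LIMSEQ_unique[OF p[of "x + y", unfolded blinfun.add_right] tendsto_add[OF p[of x] p[of y]]] .
    show "p (r *\<^sub>R x) = r *\<^sub>R p x" for r x
      using LIMSEQ_unique[OF p[of "r *\<^sub>R x", unfolded blinfun.scaleR_right]
          tendsto_scaleR[OF tendsto_const p[of x]]] .
    show "norm (p x) \<le> norm x * 1" for x
      using LIMSEQ_le_const2[OF tendsto_norm[OF p[of x]]] nT by auto
  qed
  then obtain P where P: "blinfun_apply P = p" using bounded_linear_Blinfun_apply by blast
  have lim: "(\<lambda>n. T (2 * n) x) \<longlonglongrightarrow> P x" for x using p P by simp
  have Pmem: "P \<in> \<A>" using strong_limit_mem[OF Tmem lim] .
  have Padj: "adj P = P"
    using adj_eqI'[OF Pmem strong_limit_selfadjoint[OF lim Tsa]] .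
  \<comment> \<open>Shifting the index by one multiplies by \<open>W W\<close>, so the limit is
    fixed by \<open>W W\<close>. As \<open>W\<close> is a contraction, it preserves the norm of
    \<open>P x\<close>, and \<open>Wsq\<close> then leaves no room for
    \<open>D (P x)\<close>.\<close>
  have DP: "D (P x) = 0" for x
  proof -
    have "(\<lambda>n. T (2 * Suc n) x) \<longlonglongrightarrow> P x" using LIMSEQ_Suc[OF lim[of x]] .
    moreover have "(\<lambda>n. T (2 * Suc n) x) \<longlonglongrightarrow> W (W (P x))"
      by (simp add: TS) (intro tendsto_blinfun_apply lim)
    ultimately have "P x = W (W (P x))" by (rule LIMSEQ_unique)
    then have "norm (W (P x)) = norm (P x)"
      using nW[of "P x"] nW[of "W (P x)"] by simp
    then have "2 * (norm (D (P x)))\<^sup>2 \<le> (norm (D (P x)))\<^sup>2"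
      using Wsq[of "P x"] DD[of "P x"] by simp
    then show ?thesis by simp
  qed
  have ker: "P x = x" if "D x = 0" for x
  proof -
    have "T n x = x" for n by (induction n) (simp_all add: T0 TS Wx that)
    then show ?thesis using lim[of x] by (simp add: LIMSEQ_const_iff)
  qed
  show ?thesis
  proof (rule that[OF Pmem _ Padj])
    show "\<forall>x. D x = 0 \<longrightarrow> P x = x" using ker by blast
    show "P \<odot> P = P" "D \<odot> P = 0" by (auto intro!: blinfun_eqI simp: ker DP)
    have "S \<odot> P = P \<odot> S" if S: "S \<odot> D = D \<odot> S" for S
    proof -
      have "S \<odot> (D \<odot> D) = (D \<odot> D) \<odot> S"
        using S mul_assoc[of S D D] mul_assoc[of D S D] mul_assoc[of D D S] by simp
      then have "S \<odot> W = W \<odot> S"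
        by (simp add: W_def blinfun_compose_diff_left blinfun_compose_diff_right)
      then show ?thesis using strong_limit_commute[OF lim Tcomm] by blast
    qed
    then show "\<forall>S. S \<odot> D = D \<odot> S \<longrightarrow> S \<odot> P = P \<odot> S" by blast
  qed
qed

lemma kernel_projection:
  assumes D: "D \<in> \<A>" "adj D = D"
  obtains P where "P \<in> \<A>" "P \<odot> P = P" "adj P = P" "D \<odot> P = 0" "\<forall>x. blinfun_apply D x = 0 \<longrightarrow> blinfun_apply P x = x"
    "\<forall>S. S \<odot> D = D \<odot> S \<longrightarrow> S \<odot> P = P \<odot> S"
proof (cases "D = 0")
  case True
  show ?thesis by (rule that[of id_blinfun]) (simp_all add: True unit_mem st_unit)
next
  case False
  define c where "c = inverse (norm D)"
  have c: "c \<noteq> 0" "norm (c *\<^sub>R D) \<le> 1" using False by (simp_all add: c_def)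
  have "c *\<^sub>R D \<in> \<A>" "adj (c *\<^sub>R D) = c *\<^sub>R D" using D by (simp_all add: scaleR_mem adj_scaleR)
  from kernel_projection_contraction[OF this c(2)] obtain P
    where P: "P \<in> \<A>" "P \<odot> P = P" "adj P = P" "(c *\<^sub>R D) \<odot> P = 0"
    "\<forall>x. blinfun_apply (c *\<^sub>R D) x = 0 \<longrightarrow> blinfun_apply P x = x"
    "\<forall>S. S \<odot> (c *\<^sub>R D) = (c *\<^sub>R D) \<odot> S \<longrightarrow> S \<odot> P = P \<odot> S" .
  show ?thesis
  proof (rule that[OF P(1-3)])
    show "D \<odot> P = 0" using P(4) c by (simp add: blinfun_compose_scaleR_left)
    show "\<forall>x. D x = 0 \<longrightarrow> P x = x" using P(5) by (simp add: blinfun.scaleR_left)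
    show "\<forall>S. S \<odot> D = D \<odot> S \<longrightarrow> S \<odot> P = P \<odot> S"
      using P(6) by (simp add: blinfun_compose_scaleR_left blinfun_compose_scaleR_right)
  qed
qed

text \<open>Polar decomposition \<open>K = J |K|\<close> with a symmetry \<open>J\<close>, where \<open>K' = 2 |K| - I\<close>. The second square root \<open>V\<close>
  of \<open>|K|\<close> only serves to bound the norm of \<open>K'\<close>.\<close>

lemma signed_digit:
  assumes K: "K \<in> \<A>" "adj K = K" "norm K \<le> 1"
  obtains P K' where "P \<in> \<A>" "P \<odot> P = P" "adj P = P" "K' \<in> \<A>" "adj K' = K'" "norm K' \<le> 1"
    "K = (1/2) *\<^sub>R ((id_blinfun - 2 *\<^sub>R P) \<odot> (id_blinfun + K'))"
proof -
  have n1: "norm (id_blinfun - B \<odot> B) \<le> 1" if B: "B \<in> \<A>" "adj B = B" "norm B \<le> 1" for B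
  proof (rule norm_blinfun_bound)
    fix x
    have "(norm (x - B (B x)))\<^sup>2 \<le> (norm x)\<^sup>2"
      using norm_one_minus_square[OF B(1,2), of x] power_mono[OF norm_apply_le[OF B(3), of "B x"] norm_ge_zero, of 2]
        zero_le_power2[of "norm (B x)"]
      by linarith
    then show "norm ((id_blinfun - B \<odot> B) x) \<le> 1 * norm x"
      by (simp add: blinfun.diff_left)
  qed simp
  \<comment> \<open>\<open>square_root\<close> takes roots of \<open>I - X\<close>, so the modulus
    \<open>R\<close> of \<open>K\<close> comes from \<open>X = I - K K\<close>. Its extra bound on
    \<open>I - R\<close> permits the second root.\<close>
  have "id_blinfun - K \<odot> K \<in> \<A>" "adj (id_blinfun - K \<odot> K) = id_blinfun - K \<odot> K"
    using K by (simp_all add: mem st_diff st_unit st_mul)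
  from square_root[OF this n1[OF K]]
  obtain R where R: "R \<in> \<A>" "adj R = R" "R \<odot> R = id_blinfun - (id_blinfun - K \<odot> K)"
    "norm (id_blinfun - R) \<le> 1"
    "\<forall>S. S \<odot> (id_blinfun - K \<odot> K) = (id_blinfun - K \<odot> K) \<odot> S \<longrightarrow> S \<odot> R = R \<odot> S" .
  have RR: "R \<odot> R = K \<odot> K" using R(3) by simp
  have KR: "K \<odot> R = R \<odot> K"
    by (rule R(5)[rule_format]) (simp add: blinfun_compose_diff_left blinfun_compose_diff_right mul_assoc)
  have "id_blinfun - R \<in> \<A>" "adj (id_blinfun - R) = id_blinfun - R"
    using R(1,2) by (simp_all add: mem st_diff st_unit)
  from square_root[OF this R(4)]
  obtain V where V: "V \<in> \<A>" "adj V = V" "V \<odot> V = id_blinfun - (id_blinfun - R)" by blast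
  have VV: "V (V x) = R x" for x
    using arg_cong[OF V(3), of "\<lambda>T. blinfun_apply T x"] by (simp add: blinfun.diff_left)
  have nR: "norm (R x) \<le> norm x" for x
  proof -
    have "cinner (R x) (R x) = cinner (K x) (K x)"
      using cinner_selfadjoint[OF R(1,2), of x "R x"] cinner_selfadjoint[OF K(1,2), of x "K x"]
        arg_cong[OF RR, of "\<lambda>T. blinfun_apply T x"] by simp
    then have "(norm (R x))\<^sup>2 = (norm (K x))\<^sup>2" unfolding cinner_self using of_real_eq_iff by blast
    then show ?thesis using norm_apply_le[OF K(3), of x] by simp
  qed
  have Vsq: "(norm (V x))\<^sup>2 = Re (cinner x (R x))" for x
  proof -
    have "cinner (V x) (V x) = cinner x (R x)"
      using cinner_selfadjoint[OF V(1,2), of x "V x"] by (simp add: VV)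
    from arg_cong[OF this, of Re] show ?thesis unfolding cinner_self by (simp only: Re_complex_of_real)
  qed
  have nV: "norm (V x) \<le> norm x" for x
  proof (rule power2_le_imp_le)
    show "(norm (V x))\<^sup>2 \<le> (norm x)\<^sup>2"
      unfolding Vsq using Re_cinner_le[of x "R x"] mult_left_mono[OF nR[of x] norm_ge_zero[of x]]
      by (simp add: power2_eq_square)
  qed simp
  define K' where "K' = 2 *\<^sub>R R - id_blinfun"
  have K': "K' \<in> \<A>" "adj K' = K'"
    using R(1,2) by (simp_all add: K'_def mem scaleR_mem st_diff st_unit adj_scaleR)
  \<comment> \<open>From \<open>V V = R\<close> and \<open>V\<close> being a contraction, the
    squared norm of \<open>R x\<close> is at most the inner product of \<open>x\<close> with
    \<open>R x\<close>. This makes the cross term in the expansion of \<open>2 R x - x\<close>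
    dominate.\<close>
  have nK': "norm K' \<le> 1"
  proof (rule norm_blinfun_bound)
    fix x
    have "(norm (R x))\<^sup>2 \<le> Re (cinner x (R x))"
      using nV[of "V x"] by (simp add: VV power_mono flip: Vsq)
    moreover have "Re (cinner (R x) x) = Re (cinner x (R x))"
      by (simp add: cinner_selfadjoint[OF R(1,2)])
    ultimately have "(norm (2 *\<^sub>R R x - x))\<^sup>2 \<le> (norm x)\<^sup>2"
      by (simp add: norm_diff_sq cinner_scaleR_left power_mult_distrib)
    then show "norm (K' x) \<le> 1 * norm x"
      by (simp add: K'_def blinfun.diff_left blinfun.scaleR_left)
  qed simp
  have "R + K \<in> \<A>" "adj (R + K) = R + K" using R(1,2) K by (simp_all add: mem st_add)
  from kernel_projection[OF this]
  obtain P where P: "P \<in> \<A>" "P \<odot> P = P" "adj P = P" "(R + K) \<odot> P = 0"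
    "\<forall>x. blinfun_apply (R + K) x = 0 \<longrightarrow> blinfun_apply P x = x"
    "\<forall>S. S \<odot> (R + K) = (R + K) \<odot> S \<longrightarrow> S \<odot> P = P \<odot> S" .
  have RP: "R \<odot> P = P \<odot> R" and KP: "K \<odot> P = P \<odot> K"
    by (rule P(6)[rule_format]; simp add: blinfun_compose_add_left blinfun_compose_add_right KR)+
  \<comment> \<open>\<open>P\<close> projects onto the kernel of \<open>R + K\<close>, where
    \<open>K\<close> acts as \<open>- R\<close>. Commutation gives
    \<open>(R + K)(R - K) = 0\<close>, so the range of \<open>R - K\<close> lies in that kernel;
    together with \<open>P (R + K) = 0\<close> this yields \<open>K = (I - 2P) R\<close>.\<close>
  have "P \<odot> (R - K) = R - K"
  proof (rule blinfun_eqI)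
    fix x
    have "(R + K) \<odot> (R - K) = 0"
      by (simp add: blinfun_compose_add_left blinfun_compose_diff_right RR KR)
    from arg_cong[OF this, of "\<lambda>T. blinfun_apply T x"] have "P ((R - K) x) = (R - K) x"
      by (intro P(5)[rule_format]) simp
    then show "(P \<odot> (R - K)) x = (R - K) x" by simp
  qed
  then have "P \<odot> R - P \<odot> K = R - K" by (simp add: blinfun_compose_diff_right)
  moreover have "P \<odot> R + P \<odot> K = 0"
    using P(4) by (simp add: blinfun_compose_add_left RP KP)
  ultimately have "(P \<odot> R - P \<odot> K) + (P \<odot> R + P \<odot> K) = R - K" by simp
  then have "P \<odot> R + P \<odot> R = R - K" by simp
  then have "K = R - 2 *\<^sub>R (P \<odot> R)" by (simp add: scaleR_2)
  also have "\<dots> = (1/2) *\<^sub>R ((id_blinfun - 2 *\<^sub>R P) \<odot> (id_blinfun + K'))"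
    by (simp add: K'_def blinfun_compose_diff_left blinfun_compose_scaleR_left blinfun_compose_scaleR_right
        scaleR_diff_right)
  finally show ?thesis by (rule that[OF P(1-3) K' nK'])
qed

text \<open>Iterating \<open>signed_digit\<close> replaces \<open>K\<close> by the next remainder
  \<open>K'\<close>. Since \<open>K\<close> is half of a symmetry times \<open>I + K'\<close>, an
  approximation error for \<open>K'\<close> is halved for \<open>K\<close>. Rescaling and the
  decomposition into self-adjoint parts cover the rest.\<close>

lemma projections_generate:
  assumes proj: "\<And>P. P \<in> \<A> \<Longrightarrow> P \<odot> P = P \<Longrightarrow> adj P = P \<Longrightarrow> P \<in> \<G>"
    and add: "\<And>S T. S \<in> \<G> \<Longrightarrow> T \<in> \<G> \<Longrightarrow> S + T \<in> \<G>"
    and scale: "\<And>c T. T \<in> \<G> \<Longrightarrow> c *\<^sub>C T \<in> \<G>"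
    and comp: "\<And>S T. S \<in> \<G> \<Longrightarrow> T \<in> \<G> \<Longrightarrow> S \<odot> T \<in> \<G>"
    and closed: "closed \<G>"
  shows "\<A> \<subseteq> \<G>"
proof
  have id: "id_blinfun \<in> \<G>" by (rule proj) (simp_all add: unit_mem st_unit)
  have scaleR: "T \<in> \<G> \<Longrightarrow> r *\<^sub>R T \<in> \<G>" for r T by (simp add: scaleR_blinfun_scaleC scale)
  have approx: "\<exists>g\<in>\<G>. norm (K - g) \<le> (1/2) ^ n" if "K \<in> \<A>" "adj K = K" "norm K \<le> 1" for n K
    using that
  proof (induction n arbitrary: K)
    case 0
    have "0 \<in> \<G>" by (rule proj) (simp_all add: zero_mem st_zero)
    then show ?case using 0 by force
  next
    case (Suc n)
    from signed_digit[OF Suc.prems] obtain P K' where P: "P \<in> \<A>" "P \<odot> P = P" "adj P = P"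
      and K': "K' \<in> \<A>" "adj K' = K'" "norm K' \<le> 1"
      and K: "K = (1/2) *\<^sub>R ((id_blinfun - 2 *\<^sub>R P) \<odot> (id_blinfun + K'))" .
    obtain g where g: "g \<in> \<G>" "norm (K' - g) \<le> (1/2) ^ n" using Suc.IH[OF K'] by blast
    define J where "J = id_blinfun + (- 2) *\<^sub>R P"
    have J': "J = id_blinfun - 2 *\<^sub>R P" by (simp add: J_def)
    have J: "J \<in> \<G>" unfolding J_def by (intro add id scaleR proj P)
    have "J \<in> \<A>" "adj J = J" using P by (simp_all add: J' mem scaleR_mem st_diff st_unit adj_scaleR)
    have JJ: "J \<odot> J = id_blinfun"
      by (simp add: J' scaleR_2 mul_diff_left mul_diff_right mul_add_left mul_add_right P(2))
    have nJ: "norm J \<le> 1"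
    proof (rule norm_blinfun_bound)
      fix x
      have "J (J x) = x" using arg_cong[OF JJ, of "\<lambda>T. blinfun_apply T x"] by simp
      then have "cinner (J x) (J x) = cinner x x"
        using cinner_selfadjoint[OF \<open>J \<in> \<A>\<close> \<open>adj J = J\<close>, of x "J x"] by simp
      then have "(norm (J x))\<^sup>2 = (norm x)\<^sup>2" unfolding cinner_self using of_real_eq_iff by blast
      then show "norm (J x) \<le> 1 * norm x" by simp
    qed simp
    have "(1/2) *\<^sub>R (J \<odot> (id_blinfun + g)) \<in> \<G>" by (intro scaleR comp J add id g)
    moreover have "K - (1/2) *\<^sub>R (J \<odot> (id_blinfun + g)) = (1/2) *\<^sub>R (J \<odot> (K' - g))"
      unfolding K J'[symmetric] scaleR_diff_right[symmetric] blinfun_compose_diff_right[symmetric] by simp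
    moreover have "norm ((1/2) *\<^sub>R (J \<odot> (K' - g))) \<le> (1/2) ^ Suc n"
      using norm_blinfun_compose[of J "K' - g"] mult_mono[OF nJ g(2)] by simp
    ultimately show ?case by metis
  qed
  have sa: "K \<in> \<G>" if K: "K \<in> \<A>" "adj K = K" for K
  proof -
    define c where "c = inverse (norm K + 1)"
    have p: "norm K + 1 > 0" by (simp add: add_nonneg_pos)
    then have c: "c > 0" "c * norm K \<le> 1" by (simp_all add: c_def field_simps)
    then have nc: "norm (c *\<^sub>R K) \<le> 1" by simp
    have "c *\<^sub>R K \<in> closure \<G>"
      unfolding closure_approachable
    proof (intro allI impI)
      fix \<epsilon> :: real assume "\<epsilon> > 0"
      then obtain n where n: "(1/2) ^ n < \<epsilon>" using real_arch_pow_inv[of \<epsilon> "1/2"] by auto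
      obtain g where "g \<in> \<G>" "norm (c *\<^sub>R K - g) \<le> (1/2) ^ n"
        using approx[of "c *\<^sub>R K" n] K nc by (auto simp: scaleR_mem adj_scaleR)
      with n show "\<exists>y\<in>\<G>. dist y (c *\<^sub>R K) < \<epsilon>" by (force simp: dist_norm norm_minus_commute)
    qed
    then have "inverse c *\<^sub>R (c *\<^sub>R K) \<in> \<G>" unfolding closure_closed[OF closed] by (rule scaleR)
    then show ?thesis using c by simp
  qed
  fix X assume X: "X \<in> \<A>"
  define H where "H = X + adj X"
  define K where "K = (- \<i>) *\<^sub>C (X - adj X)"
  have "H \<in> \<G>" by (rule sa) (use X in \<open>simp_all add: H_def mem st_add st_st add.commute\<close>)
  moreover have "K \<in> \<G>"
    by (rule sa) (use X in \<open>simp_all add: K_def mem st_diff st_st st_scaleC scaleC_minus_left scaleC_diff_right\<close>)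
  ultimately have "(1/2) *\<^sub>C (H + \<i> *\<^sub>C K) \<in> \<G>" by (intro scale add)
  moreover have "(1/2) *\<^sub>C (H + \<i> *\<^sub>C K) = X"
  proof -
    have "(1/2 :: complex) *\<^sub>C X + (1/2 :: complex) *\<^sub>C X = X"
      using scaleC_add_left[of "1/2" "1/2" X] by (simp add: scaleC_one)
    then show ?thesis by (simp add: H_def K_def scaleC_scaleC scaleC_one scaleC_add_right)
  qed
  ultimately show "X \<in> \<G>" by simp
qed

lemma commuting_with_projections_eq_0:
  assumes wc: "without_central_abelian_projections \<A>" and S: "S \<in> \<A>"
    and proj1: "\<And>P. P \<in> \<A> \<Longrightarrow> P \<odot> P = P \<Longrightarrow> adj P = P \<Longrightarrow> S \<odot> P = P \<odot> S"
    and proj2: "\<And>P C. P \<in> \<A> \<Longrightarrow> P \<odot> P = P \<Longrightarrow> adj P = P \<Longrightarrow> C \<in> \<A> \<Longrightarrow> S \<odot> (P \<odot> C - C \<odot> P) = 0"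
  shows "S = 0"
proof -
  \<comment> \<open>Both conditions are imposed together, since annihilation of commutators passes
    to products only with the help of commutation with \<open>S\<close>.\<close>
  define \<G> where "\<G> = {X \<in> \<A>. S \<odot> X = X \<odot> S \<and> (\<forall>C\<in>\<A>. S \<odot> (X \<odot> C - C \<odot> X) = 0)}"
  have "\<A> \<subseteq> \<G>"
  proof (rule projections_generate)
    show "P \<in> \<G>" if "P \<in> \<A>" "P \<odot> P = P" "adj P = P" for P
      using that proj1 proj2 unfolding \<G>_def by blast
    fix X Y assume X: "X \<in> \<G>" and Y: "Y \<in> \<G>"
    have "S \<odot> ((X + Y) \<odot> C - C \<odot> (X + Y)) = 0" if "C \<in> \<A>" for C
    proof -
      have "(X + Y) \<odot> C - C \<odot> (X + Y) = (X \<odot> C - C \<odot> X) + (Y \<odot> C - C \<odot> Y)"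
        by (simp add: mul_add_left mul_add_right)
      then show ?thesis using X Y that by (simp add: \<G>_def mul_add_right[of S "_ - _"])
    qed
    then show "X + Y \<in> \<G>"
      using X Y by (auto simp: \<G>_def mem mul_add_left mul_add_right)
    have "S \<odot> ((X \<odot> Y) \<odot> C - C \<odot> (X \<odot> Y)) = 0" if C: "C \<in> \<A>" for C
    proof -
      \<comment> \<open>The derivation rule for commutators; moving \<open>S\<close> past
        \<open>X\<close> brings it next to the commutator of \<open>Y\<close> and
        \<open>C\<close>.\<close>
      have "S \<odot> ((X \<odot> Y) \<odot> C - C \<odot> (X \<odot> Y)) =
          (S \<odot> X) \<odot> (Y \<odot> C - C \<odot> Y) + (S \<odot> (X \<odot> C - C \<odot> X)) \<odot> Y"
        by (simp add: mul_diff_left mul_diff_right mul_assoc)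
      also have "S \<odot> X = X \<odot> S" using X by (simp add: \<G>_def)
      also have "S \<odot> (X \<odot> C - C \<odot> X) = 0" using X C by (simp add: \<G>_def)
      finally show ?thesis using Y C by (simp add: \<G>_def mul_assoc)
    qed
    moreover have "S \<odot> (X \<odot> Y) = (X \<odot> Y) \<odot> S"
      using X Y mul_assoc[of S X Y] mul_assoc[of X S Y] mul_assoc[of X Y S] by (auto simp: \<G>_def)
    ultimately show "X \<odot> Y \<in> \<G>" using X Y by (simp add: \<G>_def mem)
  next
    fix c X assume X: "X \<in> \<G>"
    have "S \<odot> (c *\<^sub>C X \<odot> C - C \<odot> c *\<^sub>C X) = 0" if "C \<in> \<A>" for C
    proof -
      have "c *\<^sub>C X \<odot> C - C \<odot> c *\<^sub>C X = c *\<^sub>C (X \<odot> C - C \<odot> X)"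
        using that X by (simp add: mul_scaleC_left mul_scaleC_right scaleC_diff_right)
      then show ?thesis using X S that by (simp add: \<G>_def mul_scaleC_right)
    qed
    then show "c *\<^sub>C X \<in> \<G>"
      using X S by (auto simp: \<G>_def mem mul_scaleC_left mul_scaleC_right)
  next
    show "closed \<G>"
      unfolding closed_sequential_limits
    proof (intro allI impI, elim conjE)
      fix X L assume X: "\<forall>n. X n \<in> \<G>" and L: "X \<longlonglongrightarrow> L"
      have "L \<in> \<A>" using X norm_limit_mem[OF _ L] by (auto simp: \<G>_def)
      moreover have "S \<odot> L = L \<odot> S"
        using X strong_limit_commute[of X L S] blinfun.tendsto[OF L tendsto_const] by (auto simp: \<G>_def)
      moreover have "S \<odot> (L \<odot> C - C \<odot> L) = 0" if "C \<in> \<A>" for C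
      proof -
        have "(\<lambda>n. S \<odot> (X n \<odot> C - C \<odot> X n)) \<longlonglongrightarrow> S \<odot> (L \<odot> C - C \<odot> L)"
          by (intro blinfun_compose_tendsto tendsto_intros L)
        moreover have "S \<odot> (X n \<odot> C - C \<odot> X n) = 0" for n using X that by (auto simp: \<G>_def)
        ultimately show ?thesis by (simp add: LIMSEQ_const_iff)
      qed
      ultimately show "L \<in> \<G>" by (simp add: \<G>_def)
    qed
  qed
  then have central: "S \<odot> X = X \<odot> S" and annih: "S \<odot> (X \<odot> C - C \<odot> X) = 0"
    if "X \<in> \<A>" "C \<in> \<A>" for X C using that by (auto simp: \<G>_def)
  \<comment> \<open>\<open>D\<close> has the same kernel as \<open>S\<close> and is self-adjoint, as
    \<open>kernel_projection\<close> requires.\<close>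
  define D where "D = adj S \<odot> S"
  have D: "D \<in> \<A>" "adj D = D" using S by (simp_all add: D_def mem st_mul st_st)
  from kernel_projection[OF D] obtain P
    where P: "P \<in> \<A>" "P \<odot> P = P" "adj P = P" "D \<odot> P = 0" "\<forall>x. blinfun_apply D x = 0 \<longrightarrow> blinfun_apply P x = x"
    "\<forall>S. S \<odot> D = D \<odot> S \<longrightarrow> S \<odot> P = P \<odot> S" .
  define E where "E = id_blinfun - P"
  have E: "E \<in> \<A>" "E \<odot> E = E" "adj E = E"
    using P(1-3) by (simp_all add: E_def mem st_diff st_unit mul_diff_left mul_diff_right)
  have Ecomm: "E \<odot> X = X \<odot> E" if X: "X \<in> \<A>" for X
  proof -
    have "X \<odot> adj S = adj S \<odot> X"
      using arg_cong[OF central[OF adj_mem[OF X] X], of adj] X S by (simp add: st_mul mem st_st)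
    then have "X \<odot> D = adj S \<odot> (X \<odot> S)" by (simp add: D_def flip: mul_assoc)
    also have "X \<odot> S = S \<odot> X" using central[OF X X] by simp
    finally have "X \<odot> D = D \<odot> X" by (simp add: D_def mul_assoc)
    then have "X \<odot> P = P \<odot> X" using P(6) by blast
    then show ?thesis by (simp add: E_def mul_diff_left mul_diff_right)
  qed
  have EXY: "E \<odot> X \<odot> Y = E \<odot> Y \<odot> X" if X: "X \<in> \<A>" and Y: "Y \<in> \<A>" for X Y
  proof -
    have DXY: "D \<odot> (X \<odot> Y - Y \<odot> X) = 0" using annih[OF X Y] by (simp add: D_def mul_assoc)
    have "P \<odot> (X \<odot> Y - Y \<odot> X) = X \<odot> Y - Y \<odot> X"
    proof (rule blinfun_eqI)
      fix x
      show "(P \<odot> (X \<odot> Y - Y \<odot> X)) x = (X \<odot> Y - Y \<odot> X) x"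
        using arg_cong[OF DXY, of "\<lambda>T. blinfun_apply T x"] P(5) by simp
    qed
    then have "E \<odot> (X \<odot> Y - Y \<odot> X) = 0" by (simp add: E_def mul_diff_left)
    then show ?thesis by (simp add: mul_diff_right mul_assoc)
  qed
  have EE: "E \<odot> X \<odot> E = E \<odot> X" if "X \<in> \<A>" for X
    using Ecomm[OF that] E(2) mul_assoc[of E X E] mul_assoc[of E E X] by simp
  have "central_abelian_projection \<A> E"
    unfolding central_abelian_projection_def
  proof (intro conjI ballI E Ecomm)
    fix X Y assume "X \<in> \<A>" "Y \<in> \<A>"
    then show "E \<odot> X \<odot> E \<odot> (E \<odot> Y \<odot> E) = E \<odot> Y \<odot> E \<odot> (E \<odot> X \<odot> E)"
      using EXY[of X Y] by (simp add: EE flip: mul_assoc)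
  qed
  \<comment> \<open>Then \<open>P\<close> is the identity, and \<open>D P = 0\<close> says
    \<open>D = 0\<close>.\<close>
  then have "E = 0" using wc by (auto simp: without_central_abelian_projections_def)
  then have "D = 0" using P(4) by (simp add: E_def)
  show ?thesis
  proof (rule blinfun_eqI)
    fix x
    have "cinner (S x) (S x) = cinner x (D x)" using cinner_adj'[OF S, of x "S x"] by (simp add: D_def)
    then show "blinfun_apply S x = blinfun_apply 0 x" using \<open>D = 0\<close> by (simp add: cinner_self)
  qed
qed

end

section \<open>Reduction to two variables\<close>

text \<open>The scalar \<open>c\<close> with \<open>p\<^sub>k\<^sub>+\<^sub>1(I, \<dots>, I, X) = c X\<close>.\<close>

fun unit_coeff :: "complex \<Rightarrow> nat \<Rightarrow> complex" where
  "unit_coeff \<eta> 0 = 1"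
| "unit_coeff \<eta> (Suc k) = unit_coeff \<eta> k + \<eta> * cnj (unit_coeff \<eta> k)"

text \<open>If the coefficient after \<open>a\<close> vanishes, then
  \<open>\<eta> cnj a = - a\<close>, so \<open>\<eta>\<close> has modulus 1. For
  \<open>a = b + \<eta> cnj b\<close> this modulus forces \<open>\<eta> cnj a = a\<close>, hence
  \<open>a = 0\<close>. The first step has no such \<open>b\<close> and uses the hypothesis on
  \<open>\<eta>\<close>.\<close>

lemma unit_coeff_nz:
  assumes "\<eta> \<noteq> -1"
  shows "unit_coeff \<eta> k \<noteq> 0"
proof (induction k)
  case (Suc k)
  show ?case
  proof (cases k)
    case 0
    then show ?thesis using assms by (simp add: add_eq_0_iff)
  next
    case (Suc j)
    define a where "a = unit_coeff \<eta> k"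
    define b where "b = unit_coeff \<eta> j"
    have a: "a = b + \<eta> * cnj b" by (simp add: a_def b_def Suc)
    show ?thesis
    proof
      assume "unit_coeff \<eta> (Suc k) = 0"
      then have 0: "\<eta> * cnj a = - a" by (simp add: a_def eq_neg_iff_add_eq_0 add.commute)
      then have "cmod \<eta> * cmod a = cmod a" by (metis complex_mod_cnj norm_minus_cancel norm_mult)
      then have "cmod \<eta> = 1" using Suc.IH by (simp add: a_def)
      then have 1: "\<eta> * cnj \<eta> = 1" by (simp add: complex_norm_square[symmetric])
      have "\<eta> * cnj a = \<eta> * cnj b + (\<eta> * cnj \<eta>) * b" by (simp add: a algebra_simps)
      then have "\<eta> * cnj a = a" unfolding 1 by (simp add: a)
      then show False using 0 Suc.IH by (simp add: a_def)
    qed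
  qed
qed simp

text \<open>\<open>T\<close> is generalized because the induction hypothesis is applied to the
  identity. For \<open>k = 0\<close> the product of a one-element list is that element.\<close>

lemma (in von_neumann_alg) jordan_n_prod_units:
  "T \<in> \<A> \<Longrightarrow> jordan_n_prod (o\<^sub>L) adj \<eta> (replicate k id_blinfun @ [T]) = unit_coeff \<eta> k *\<^sub>C T"
proof (induction k arbitrary: T)
  case 0
  show ?case by (simp add: jordan_n_prod_def scaleC_one)
next
  case (Suc k)
  define u where "u = replicate k (id_blinfun :: 'h \<Rightarrow>\<^sub>L 'h) @ [id_blinfun]"
  have "replicate (Suc k) id_blinfun = u" by (simp add: u_def replicate_append_same)
  then show ?case
    using jordan_n_prod_snoc[of u "(o\<^sub>L)" adj \<eta> T] Suc.IH[OF unit_mem] Suc.prems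
    by (simp add: u_def jordan_prod_def mul_scaleC_left mul_scaleC_right st_scaleC unit_mem st_unit
        scaleC_scaleC scaleC_add_left)
qed

lemma jordan_prod_add:
  fixes u v w :: "'b::star_algebra"
  shows "jordan_prod (*) star \<eta> (u + v) w = jordan_prod (*) star \<eta> u w + jordan_prod (*) star \<eta> v w"
    and "jordan_prod (*) star \<eta> w (u + v) = jordan_prod (*) star \<eta> w u + jordan_prod (*) star \<eta> w v"
  by (simp_all add: jordan_prod_def algebra_simps star_add scaleC_add_right)

text \<open>The empty prefix occurs for \<open>n = 2\<close>, where \<open>G\<close> is the two-fold
  product itself.\<close>

lemma jordan_n_prod_add_last:
  fixes u v :: "'b::star_algebra"
  shows "jordan_n_prod (*) star \<eta> (xs @ [u + v]) =
    jordan_n_prod (*) star \<eta> (xs @ [u]) + jordan_n_prod (*) star \<eta> (xs @ [v])"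
  by (cases "xs = []") (simp_all add: jordan_n_prod_snoc jordan_prod_add, simp add: jordan_n_prod_def)

lemma jordan_n_prod_snoc2:
  "jordan_n_prod mul invol \<eta> (xs @ [u, w]) =
    jordan_prod mul invol \<eta> (jordan_n_prod mul invol \<eta> (xs @ [u])) w"
  using jordan_n_prod_snoc[of "xs @ [u]" mul invol \<eta> w] by simp

theorem theorem3p1:
  fixes \<A> :: "('h::complex_hilbert_space \<Rightarrow>\<^sub>L 'h) set"
    and \<phi> :: "('h \<Rightarrow>\<^sub>L 'h) \<Rightarrow> 'b::star_algebra"
    and \<eta> :: complex
    and n :: nat
  assumes "n \<ge> 2"
    and "von_neumann_algebra \<A>"
    and "without_central_abelian_projections \<A>"
    and "\<eta> \<noteq> 0" and "\<eta> \<noteq> -1"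
    and "bij_betw \<phi> \<A> UNIV"
    and "\<And>xs. length xs = n \<Longrightarrow> set xs \<subseteq> \<A> \<Longrightarrow>
           \<phi> (jordan_n_prod (o\<^sub>L) adj \<eta> xs) = jordan_n_prod (*) star \<eta> (map \<phi> xs)"
  shows "\<forall>A\<in>\<A>. \<forall>B\<in>\<A>. \<phi> (A + B) = \<phi> A + \<phi> B"
proof -
  interpret von_neumann_alg \<A> by unfold_locales fact
  \<comment> \<open>\<open>k\<close> identities precede the two variables. Since \<open>x\<close> is
    first scaled by \<open>\<alpha>\<close>, its adjoint contributes \<open>cnj \<alpha>\<close> to
    \<open>\<beta>\<close>, and \<open>\<alpha> + \<beta>\<close> is the next unit
    coefficient.\<close>
  define k where "k = n - 2"
  define \<alpha> where "\<alpha> = unit_coeff \<eta> k"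
  define \<beta> where "\<beta> = \<eta> * cnj \<alpha>"
  define G where "G u v = jordan_n_prod (*) star \<eta> (replicate k (\<phi> id_blinfun) @ [u, v])" for u v
  have \<alpha>: "\<alpha> \<noteq> 0" using unit_coeff_nz[OF assms(5)] by (simp add: \<alpha>_def)
  interpret jordan_star_morphism \<A> "(o\<^sub>L)" adj id_blinfun \<phi> G \<alpha> \<beta>
  proof
    show "bij_betw \<phi> \<A> UNIV" by fact
    show "G (u + v) w = G u w + G v w" and "G w (u + v) = G w u + G w v" for u v w
      by (simp_all add: G_def jordan_n_prod_snoc2 jordan_n_prod_add_last jordan_prod_add)
    show "\<alpha> \<noteq> 0" by (rule \<alpha>)
    then show "\<beta> \<noteq> 0" using assms(4) by (simp add: \<beta>_def)
    show "\<alpha> + \<beta> \<noteq> 0"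
      using unit_coeff_nz[OF assms(5), of "Suc k"] by (simp add: \<alpha>_def \<beta>_def)
    have "1 + cnj \<eta> \<noteq> 0" using assms(5) by (metis add_eq_0_iff complex_cnj_cnj complex_cnj_minus complex_cnj_one)
    moreover have "\<alpha> + cnj \<beta> = \<alpha> * (1 + cnj \<eta>)" by (simp add: \<beta>_def algebra_simps)
    ultimately show "\<alpha> + cnj \<beta> \<noteq> 0" using \<alpha> by (simp only: mult_eq_0_iff) simp
    fix x y :: "'h \<Rightarrow>\<^sub>L 'h"
    assume xy: "x \<in> \<A>" "y \<in> \<A>"
    have "jordan_n_prod (o\<^sub>L) adj \<eta> (replicate k id_blinfun @ [x, y]) =
        \<alpha> *\<^sub>C (x o\<^sub>L y) + \<beta> *\<^sub>C (y o\<^sub>L adj x)"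
      using xy by (simp add: jordan_n_prod_snoc2 jordan_n_prod_units jordan_prod_def mul_scaleC_left
          mul_scaleC_right st_scaleC scaleC_scaleC \<alpha>_def[symmetric] \<beta>_def)
    moreover have "set (replicate k id_blinfun @ [x, y]) \<subseteq> \<A>"
      using xy unit_mem by (auto simp: set_replicate_conv_if)
    moreover have "length (replicate k id_blinfun @ [x, y]) = n"
      using assms(1) by (simp add: k_def)
    ultimately show "\<phi> (\<alpha> *\<^sub>C (x o\<^sub>L y) + \<beta> *\<^sub>C (y o\<^sub>L adj x)) = G (\<phi> x) (\<phi> y)"
      using assms(7)[of "replicate k id_blinfun @ [x, y]"] by (simp add: G_def)
  qed
  show ?thesis
  proof (intro ballI)
    fix A B assume A: "A \<in> \<A>" and B: "B \<in> \<A>"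
    obtain T where T: "T \<in> \<A>" "\<phi> T = \<phi> A + \<phi> B" by (rule \<phi>_surj)
    have "T - (A + B) = 0"
    proof (rule commuting_with_projections_eq_0[OF assms(3)])
      show "T - (A + B) \<in> \<A>" using A B T by (simp add: mem)
      fix P C assume P: "P \<in> \<A>" "P o\<^sub>L P = P" "adj P = P"
      show "(T - (A + B)) o\<^sub>L P = P o\<^sub>L (T - (A + B))"
        by (rule defect_projection(1)[OF P A B T unit_mem])
      show "C \<in> \<A> \<Longrightarrow> (T - (A + B)) o\<^sub>L ((P o\<^sub>L C) - (C o\<^sub>L P)) = 0"
        by (rule defect_projection(2)[OF P A B T])
    qed
    then show "\<phi> (A + B) = \<phi> A + \<phi> B" using T by simp
  qed
qed

end
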